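(* Let $n\ge 1$, let $b$ be a locally integrable function on $\mathbb{R}^n$ and let $0<\beta<1$. Suppose that $1<p<n/\beta$ and $1/q=1/p-\beta/n$. Then the following statements are equivalent: (1) $b\in\dot{\Lambda}_{\beta}(\mathbb{R}^n)$ and $b\ge 0$. (2) The commutator $[b,M]$ is bounded from $L^p(\mathbb{R}^n)$ to $L^q(\mathbb{R}^n)$. (3) There exists a constant $C>0$ such that $$\sup_{Q}\frac{1}{|Q|^{\beta/n}}\bigg(\frac{1}{|Q|}\int_Q|b(x)-M_Q(b)(x)|^q\,dx\bigg)^{1/q}\le C,$$ where the supremum is over all cubes $Q\subset\mathbb{R}^n$.
   Context: Cubes have sides parallel to the coordinate axes; $|E|$ denotes Lebesgue measure. The Hardy-Littlewood maximal function is $$M(f)(x)=\sup_{Q\ni x}\frac{1}{|Q|}\int_Q|f(y)|\,dy,$$ the supremum being over all cubes $Q\subset\mathbb{R}^n$ containing $x$. For a locally integrable function $b$, the (nonlinear) commutator is $$[b,M](f)(x)=b(x)M(f)(x)-M(bf)(x).$$ "$[b,M]$ is bounded from $X$ to $Y$" means that there is a constant $C$ such that, for all $f\in X$, $[b,M](f)$ is well defined a.e. and $\|[b,M](f)\|_Y\le C\|f\|_X$. For a fixed cube $Q_0$, the Hardy-Littlewood maximal function with respect to $Q_0$ is $$M_{Q_0}(f)(x)=\sup_{Q_0\supseteq Q\ni x}\frac{1}{|Q|}\int_Q|f(y)|\,dy,\qquad x\in Q_0,$$ the supremum being over all cubes $Q$ with $Q\subseteq Q_0$ and $x\in Q$.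 For $0<\beta<1$, a function $b$ belongs to the Lipschitz space $\dot{\Lambda}_{\beta}(\mathbb{R}^n)$ if there is a constant $C$ such that $|b(x)-b(y)|\le C|x-y|^{\beta}$ for all $x,y\in\mathbb{R}^n$. As usual, functions are identified if they agree almost everywhere, so for a locally integrable $b$, $b\in\dot{\Lambda}_{\beta}(\mathbb{R}^n)$ means that $b$ agrees a.e. with a function satisfying this condition, and $b\ge0$ is understood a.e. *)

theory Defs
  imports "HOL-Analysis.Analysis"
begin

text \<open>Nonnegative quantities that may be infinite (maximal functions, integrals, norms) are
  kept in \<^typ>\<open>ennreal\<close>, so that nothing is silently truncated to a finite value.
  \<^typ>\<open>ennreal\<close> has no real powers in the library; the following is \<open>x\<^sup>r\<close>
  for \<open>x \<in> [0,\<infinity>]\<close> and is only used with \<open>r > 0\<close>, so that \<open>\<infinity>\<^sup>r = \<infinity>\<close>.\<close>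

definition ennpow :: "ennreal \<Rightarrow> real \<Rightarrow> ennreal" where
  "ennpow x r = (if x = \<infinity> then \<infinity> else ennreal (enn2real x powr r))"

text \<open>Closed, nondegenerate cubes with sides parallel to the axes; \<^term>\<open>vec l\<close> is the vector
  all of whose components equal \<open>l\<close>.\<close>

definition cubes :: "(real ^ 'n) set set" where
  "cubes = {cbox a (a + vec l) | a l. l > 0}"

definition maximal_on :: "(real ^ 'n) set \<Rightarrow> (real ^ 'n \<Rightarrow> real) \<Rightarrow> real ^ 'n \<Rightarrow> ennreal" where
  "maximal_on Q\<^sub>0 f x =
     (SUP Q \<in> {Q \<in> cubes. Q \<subseteq> Q\<^sub>0 \<and> x \<in> Q}.
        (\<integral>\<^sup>+ y \<in> Q. ennreal \<bar>f y\<bar> \<partial>lebesgue) / emeasure lebesgue Q)"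

definition maximal :: "(real ^ 'n \<Rightarrow> real) \<Rightarrow> real ^ 'n \<Rightarrow> ennreal" where
  "maximal f x =
     (SUP Q \<in> {Q \<in> cubes. x \<in> Q}.
        (\<integral>\<^sup>+ y \<in> Q. ennreal \<bar>f y\<bar> \<partial>lebesgue) / emeasure lebesgue Q)"

definition locally_integrable :: "(real ^ 'n \<Rightarrow> real) \<Rightarrow> bool" where
  "locally_integrable b \<longleftrightarrow> (\<forall>K. compact K \<longrightarrow> set_integrable lebesgue K b)"

text \<open>Real-valued functions enter the next two definitions through the embedding into
  \<^typ>\<open>ereal\<close>; extended values are allowed because commutators may take them.\<close>

definition Lp_norm :: "real \<Rightarrow> (real ^ 'n \<Rightarrow> ereal) \<Rightarrow> ennreal" where
  "Lp_norm p f = ennpow (\<integral>\<^sup>+ x. ennpow (e2ennreal \<bar>f x\<bar>) p \<partial>lebesgue) (1 / p)"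

definition Lp_space :: "real \<Rightarrow> (real ^ 'n \<Rightarrow> ereal) set" where
  "Lp_space p = {f \<in> borel_measurable lebesgue. Lp_norm p f < \<infinity>}"

definition commutator ::
    "(real ^ 'n \<Rightarrow> real) \<Rightarrow> (real ^ 'n \<Rightarrow> real) \<Rightarrow> real ^ 'n \<Rightarrow> ereal" where
  "commutator b f x =
     ereal (b x) * enn2ereal (maximal f x) - enn2ereal (maximal (\<lambda>y. b y * f y) x)"

text \<open>\<open>\<infinity> - \<infinity>\<close> is the only indeterminate case.\<close>

definition commutator_defined_at ::
    "(real ^ 'n \<Rightarrow> real) \<Rightarrow> (real ^ 'n \<Rightarrow> real) \<Rightarrow> real ^ 'n \<Rightarrow> bool" where
  "commutator_defined_at b f x \<longleftrightarrow>
     \<not> (ereal (b x) * enn2ereal (maximal f x) = \<infinity> \<and> maximal (\<lambda>y. b y * f y) x = \<infinity>)"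

definition commutator_bounded :: "(real ^ 'n \<Rightarrow> real) \<Rightarrow> real \<Rightarrow> real \<Rightarrow> bool" where
  "commutator_bounded b p q \<longleftrightarrow>
     (\<exists>C\<ge>0. \<forall>f :: real ^ 'n \<Rightarrow> real. (\<lambda>x. ereal (f x)) \<in> Lp_space p \<longrightarrow>
        (AE x in lebesgue. commutator_defined_at b f x) \<and>
        commutator b f \<in> Lp_space q \<and>
        Lp_norm q (commutator b f) \<le> ennreal C * Lp_norm p (\<lambda>x. ereal (f x)))"

definition lipschitz_class :: "real \<Rightarrow> (real ^ 'n \<Rightarrow> real) set" where
  "lipschitz_class \<beta> = {g. \<exists>C. \<forall>x y. \<bar>g x - g y\<bar> \<le> C * norm (x - y) powr \<beta>}"

text \<open>Membership in the Lipschitz space for functions identified up to null sets.\<close>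

definition lipschitz_space :: "real \<Rightarrow> (real ^ 'n \<Rightarrow> real) set" where
  "lipschitz_space \<beta> = {b. \<exists>g \<in> lipschitz_class \<beta>. AE x in lebesgue. b x = g x}"

definition oscillation :: "(real ^ 'n \<Rightarrow> real) \<Rightarrow> real \<Rightarrow> real \<Rightarrow> (real ^ 'n) set \<Rightarrow> ennreal" where
  "oscillation b \<beta> q Q =
     ennpow ((\<integral>\<^sup>+ x \<in> Q. ennpow (e2ennreal \<bar>ereal (b x) - enn2ereal (maximal_on Q b x)\<bar>) q \<partial>lebesgue)
               / emeasure lebesgue Q) (1 / q)
     / ennpow (emeasure lebesgue Q) (\<beta> / real CARD('n))"

end

theory Submission
  imports Defs
begin

text \<open>(1) \<open>\<Longrightarrow>\<close> (2): if \<open>b \<ge> 0\<close> is \<open>\<beta>\<close>-Lipschitz, then \<open>\<bar>[b, M] f\<bar>\<close> is pointwise at most a constant times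
  the fractional maximal function of \<open>f\<close>, which Hedberg's inequality bounds by
  \<open>\<parallel>f\<parallel>\<^bsup>\<beta>p/n\<^esup> (M f)\<^bsup>p/q\<^esup>\<close>; the Hardy-Littlewood theorem finishes.
  (2) \<open>\<Longrightarrow>\<close> (3): test the commutator on the indicator function of a cube \<open>Q\<close>; on \<open>Q\<close> one has
  \<open>M 1\<^sub>Q = 1\<close> and \<open>M (b 1\<^sub>Q) = M\<^sub>Q b\<close>.
  (3) \<open>\<Longrightarrow>\<close> (1): let \<open>A\<close> be the average of \<open>\<bar>b\<bar>\<close> over \<open>Q\<close>. Since \<open>M\<^sub>Q b \<ge> A\<close> on \<open>Q\<close>, (3) bounds the mean of
  \<open>(A - b)\<^sup>+\<close>, hence also the means of \<open>\<bar>b\<bar> - b\<close> and \<open>\<bar>b - A\<bar>\<close>, by a multiple of \<open>\<bar>Q\<bar>\<^bsup>\<beta>/n\<^esup>\<close>. A nonnegative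
  function whose mean over every cube decays like this vanishes a.e. (subdivide the cube), so \<open>b \<ge> 0\<close>;
  and by Campanato's argument the averages \<open>A\<close> converge to a Lipschitz function equal to \<open>b\<close> a.e.\<close>

subsection \<open>Powers, cubes and averages\<close>

lemma ennpow_ennreal: "0 \<le> x \<Longrightarrow> ennpow (ennreal x) r = ennreal (x powr r)"
  by (simp add: ennpow_def)

lemma ennpow_top [simp]: "ennpow top r = top"
  by (simp add: ennpow_def)

lemma ennpow_zero [simp]: "ennpow 0 r = 0"
  by (simp add: ennpow_def)

lemma ennpow_one_right [simp]: "ennpow x 1 = x"
  by (cases x) (auto simp: ennpow_ennreal)

lemma ennpow_mono: "x \<le> y \<Longrightarrow> 0 \<le> r \<Longrightarrow> ennpow x r \<le> ennpow y r"
  by (cases x; cases y) (auto simp: ennpow_ennreal powr_mono2 top_unique)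

lemma ennpow_mult: "0 < r \<Longrightarrow> ennpow (x * y) r = ennpow x r * ennpow y r"
proof (cases x; cases y)
  fix a b assume "x = ennreal a" "0 \<le> a" "y = ennreal b" "0 \<le> b"
  then show ?thesis
    by (simp add: ennpow_ennreal powr_mult flip: ennreal_mult)
qed (auto simp: ennpow_ennreal ennreal_mult_top ennreal_top_mult)

lemma ennpow_ennpow: "ennpow (ennpow x r) s = ennpow x (r * s)"
  by (cases x) (auto simp: ennpow_ennreal powr_powr)

text \<open>On \<open>[0,\<infinity>]\<close> the maps \<open>x powr r\<close> and
  \<open>x powr (1 / r)\<close> are monotone and mutually inverse. This turns bounds on norms into
  bounds on integrals.\<close>

lemma ennpow_le_iff:
  assumes "0 < r"
  shows "ennpow x (1 / r) \<le> y \<longleftrightarrow> x \<le> ennpow y r"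
  using assms ennpow_mono[of "ennpow x (1/r)" y r] ennpow_mono[of x "ennpow y r" "1/r"]
  by (auto simp: ennpow_ennpow)

lemma ennpow_measurable [measurable (raw)]:
  assumes "f \<in> borel_measurable M"
  shows "(\<lambda>x. ennpow (f x) r) \<in> borel_measurable M"
  using assms unfolding ennpow_def by measurable

lemma divide_ennreal_le_iff: "0 < c \<Longrightarrow> u / ennreal c \<le> v \<longleftrightarrow> u \<le> v * ennreal c"
proof (cases u; cases v)
  fix a b assume "0 < c" "u = ennreal a" "0 \<le> a" "v = ennreal b" "0 \<le> b"
  then show ?thesis
    by (simp add: divide_ennreal ennreal_mult[symmetric] pos_divide_le_eq del: ennreal_mult' ennreal_mult'')
qed (auto simp: ennreal_top_divide ennreal_divide_top ennreal_top_mult top_unique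
       divide_ennreal ennreal_mult_eq_top_iff)

lemma cbox_in_sets_lebesgue [measurable]: "cbox a b \<in> sets lebesgue"
  by simp

lemma emeasure_cube:
  "0 \<le> l \<Longrightarrow> emeasure lborel (cbox a (a + vec l) :: (real ^ 'n) set) = ennreal (l ^ CARD('n))"
proof -
  assume l: "0 \<le> l"
  have "a \<in> cbox a (a + vec l)"
    using l by (simp add: mem_box_cart)
  then have "measure lborel (cbox a (a + vec l)) = l ^ CARD('n)"
    by (subst content_cbox_cart) auto
  moreover have "emeasure lborel (cbox a (a + vec l)) \<noteq> top"
    using emeasure_lborel_cbox_finite[of a "a + vec l"] by simp
  ultimately show ?thesis
    by (metis emeasure_eq_ennreal_measure)
qed

lemma ball_cubes_iff:
  "(\<forall>Q \<in> {Q \<in> cubes. P Q}. R Q) \<longleftrightarrow> (\<forall>a l. 0 < l \<longrightarrow> P (cbox a (a + vec l)) \<longrightarrow> R (cbox a (a + vec l)))"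
  by (auto simp: cubes_def)

lemma cube_average_le_iff:
  fixes a :: "real ^ 'n"
  assumes "0 < l"
  shows "u / emeasure lborel (cbox a (a + vec l)) \<le> v \<longleftrightarrow> u \<le> v * ennreal (l ^ CARD('n))"
  using assms by (simp add: emeasure_cube divide_ennreal_le_iff)

text \<open>Removes both the supremum and the division: a bound on the maximal function is
  henceforth checked as an integral inequality over each cube through \<open>x\<close>.\<close>

lemma maximal_le_iff:
  fixes f :: "real ^ 'n \<Rightarrow> real"
  shows "maximal f x \<le> v \<longleftrightarrow> (\<forall>a l. 0 < l \<longrightarrow> x \<in> cbox a (a + vec l) \<longrightarrow>
    (\<integral>\<^sup>+ y \<in> cbox a (a + vec l). ennreal \<bar>f y\<bar> \<partial>lebesgue) \<le> v * ennreal (l ^ CARD('n)))"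
  unfolding maximal_def SUP_le_iff ball_cubes_iff by (simp add: cube_average_le_iff)

lemma maximal_on_le_iff:
  fixes f :: "real ^ 'n \<Rightarrow> real"
  shows "maximal_on Q f x \<le> v \<longleftrightarrow> (\<forall>a l. 0 < l \<longrightarrow> cbox a (a + vec l) \<subseteq> Q \<longrightarrow> x \<in> cbox a (a + vec l) \<longrightarrow>
    (\<integral>\<^sup>+ y \<in> cbox a (a + vec l). ennreal \<bar>f y\<bar> \<partial>lebesgue) \<le> v * ennreal (l ^ CARD('n)))"
  unfolding maximal_on_def SUP_le_iff ball_cubes_iff by (simp add: cube_average_le_iff imp_conjL)

text \<open>The instance \<open>v = maximal f x\<close>, used to estimate a single integral by the
  maximal function.\<close>

lemmas nn_integral_cube_le_maximal = maximal_le_iff[THEN iffD1, OF order_refl, rule_format]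

lemmas nn_integral_cube_le_maximal_on = maximal_on_le_iff[THEN iffD1, OF order_refl, rule_format]

text \<open>A substitute for Jensen's inequality, from \<open>h \<le> T + T\<^bsup>1-p\<^esup> h\<^bsup>p\<^esup>\<close>.\<close>

lemma nn_integral_cube_le_of_ennpow:
  fixes h :: "real ^ 'n \<Rightarrow> ennreal"
  assumes [measurable]: "h \<in> borel_measurable lebesgue"
    and l: "0 < l" and p: "1 < p" and T: "0 < T"
    and h: "(\<integral>\<^sup>+ x \<in> cbox a (a + vec l). ennpow (h x) p \<partial>lebesgue) \<le> ennreal (T powr p * l ^ CARD('n))"
  shows "(\<integral>\<^sup>+ x \<in> cbox a (a + vec l). h x \<partial>lebesgue) \<le> ennreal (2 * T * l ^ CARD('n))"
proof -
  let ?Q = "cbox a (a + vec l)"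
  have [measurable]: "(\<lambda>x. ennpow (h x) p * indicator ?Q x) \<in> borel_measurable lebesgue"
    using assms(1) by (intro borel_measurable_times_ennreal ennpow_measurable borel_measurable_indicator) auto
  \<comment> \<open>If \<open>v\<close> exceeds \<open>T\<close>, then \<open>v powr (1 - p)\<close>
    is at most \<open>T powr (1 - p)\<close> because the exponent is negative.\<close>
  have young: "u \<le> ennreal T + ennreal (T powr (1 - p)) * ennpow u p" for u
  proof (cases u)
    case (real v)
    have "v \<le> T + T powr (1 - p) * v powr p"
    proof (cases "v \<le> T")
      case False
      then have "v = v powr (1 - p) * v powr p"
        using T by (simp flip: powr_add)
      also have "\<dots> \<le> T powr (1 - p) * v powr p"
        using False T p by (intro mult_right_mono powr_mono2') auto
      finally show ?thesis
        using T by simp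
    qed (simp add: add_increasing2)
    then show ?thesis
      using real T by (simp add: ennpow_ennreal flip: ennreal_mult ennreal_plus)
  qed (use T in \<open>simp add: ennreal_mult_top\<close>)
  have "(\<integral>\<^sup>+ x \<in> ?Q. h x \<partial>lebesgue)
      \<le> (\<integral>\<^sup>+ x. ennreal T * indicator ?Q x + ennreal (T powr (1 - p)) * (ennpow (h x) p * indicator ?Q x) \<partial>lebesgue)"
    using young by (intro nn_integral_mono) (auto simp: indicator_def)
  also have "\<dots> = ennreal T * ennreal (l ^ CARD('n))
      + ennreal (T powr (1 - p)) * (\<integral>\<^sup>+ x \<in> ?Q. ennpow (h x) p \<partial>lebesgue)"
    using l by (subst nn_integral_add) (simp_all add: nn_integral_cmult nn_integral_cmult_indicator emeasure_cube)
  also have "\<dots> \<le> ennreal T * ennreal (l ^ CARD('n))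
      + ennreal (T powr (1 - p)) * ennreal (T powr p * l ^ CARD('n))"
    using h by (intro add_left_mono mult_left_mono) auto
  also have "\<dots> = ennreal (T * l ^ CARD('n) + T powr (1 - p) * (T powr p * l ^ CARD('n)))"
    using T l by (simp flip: ennreal_mult ennreal_plus)
  also have "T powr (1 - p) * (T powr p * l ^ CARD('n)) = T * l ^ CARD('n)"
    using T by (simp flip: powr_add mult.assoc)
  finally show ?thesis
    by (simp add: algebra_simps)
qed

text \<open>The truncations of \<open>b\<close> to balls of integer radius are integrable, hence
  measurable, and converge pointwise to \<open>b\<close>.\<close>

lemma locally_integrable_measurable:
  fixes b :: "real ^ 'n \<Rightarrow> real"
  assumes "locally_integrable b"
  shows "b \<in> borel_measurable lebesgue"
proof (rule borel_measurable_LIMSEQ_real)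
  show "(\<lambda>x. indicator (cball 0 (real k)) x *\<^sub>R b x) \<in> borel_measurable lebesgue" for k
    using assms borel_measurable_integrable compact_cball
    unfolding locally_integrable_def set_integrable_def by blast
next
  fix x :: "real ^ 'n"
  obtain k where k: "norm x \<le> real k"
    using real_arch_simple by blast
  have "\<forall>\<^sub>F i in sequentially. indicator (cball 0 (real i)) x *\<^sub>R b x = b x"
    using eventually_ge_at_top[of k] by eventually_elim (use k in \<open>auto simp: indicator_def\<close>)
  then show "(\<lambda>i. indicator (cball 0 (real i)) x *\<^sub>R b x) \<longlonglongrightarrow> b x"
    by (rule tendsto_eventually)
qed

text \<open>The Euclidean norm is at most the sum of the absolute coordinates, each at most
  \<open>l\<close>; the sharp constant, the square root of the dimension, would bring no gain
  here.\<close>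

lemma norm_diff_le_cube:
  fixes x y :: "real ^ 'n"
  assumes "x \<in> cbox a (a + vec l)" "y \<in> cbox a (a + vec l)"
  shows "norm (x - y) \<le> real CARD('n) * l"
proof -
  have "\<bar>(x - y) $ i\<bar> \<le> l" for i
    using assms unfolding mem_box_cart by (simp add: abs_le_iff) (smt (verit))
  then have "(\<Sum>i\<in>UNIV. \<bar>(x - y) $ i\<bar>) \<le> (\<Sum>i\<in>(UNIV :: 'n set). l)"
    by (intro sum_mono)
  then show ?thesis
    using norm_le_l1_cart[of "x - y"] by simp
qed

lemma norm_powr_le_cube:
  fixes x y :: "real ^ 'n"
  assumes "x \<in> cbox a (a + vec l)" "y \<in> cbox a (a + vec l)" "0 \<le> l" "0 \<le> \<beta>"
  shows "norm (x - y) powr \<beta> \<le> real CARD('n) powr \<beta> * l powr \<beta>"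
  using powr_mono2[OF assms(4) norm_ge_zero norm_diff_le_cube[OF assms(1,2)]] assms(3)
  by (simp add: powr_mult)

text \<open>Clears the root and the divisions, using that the volume \<open>l ^ CARD('n)\<close> to
  the power \<beta>/n is \<open>l powr \<beta>\<close>.\<close>

lemma oscillation_le_iff:
  fixes b :: "real ^ 'n \<Rightarrow> real"
  assumes l: "0 < l" and q: "0 < q" and C: "0 \<le> C"
  shows "oscillation b \<beta> q (cbox a (a + vec l)) \<le> ennreal C \<longleftrightarrow>
    (\<integral>\<^sup>+ x \<in> cbox a (a + vec l). ennpow (e2ennreal \<bar>ereal (b x) -
        enn2ereal (maximal_on (cbox a (a + vec l)) b x)\<bar>) q \<partial>lebesgue)
      \<le> ennreal ((C * l powr \<beta>) powr q * l ^ CARD('n))"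
proof -
  have pow: "ennpow (ennreal (l ^ CARD('n))) (\<beta> / real CARD('n)) = ennreal (l powr \<beta>)"
    using l by (simp add: ennpow_ennreal powr_powr flip: powr_realpow)
  have "ennreal C * ennreal (l powr \<beta>) = ennreal (C * l powr \<beta>)"
    using C by (intro ennreal_mult[symmetric]) auto
  moreover have "ennreal ((C * l powr \<beta>) powr q) * ennreal (l ^ CARD('n))
      = ennreal ((C * l powr \<beta>) powr q * l ^ CARD('n))"
    using l by (intro ennreal_mult[symmetric]) auto
  ultimately show ?thesis
    using l q C
    by (simp add: oscillation_def emeasure_cube pow divide_ennreal_le_iff ennpow_le_iff ennpow_ennreal)
qed

text \<open>A countable cover for \<open>lborel\<close> serves for the completion as well. Needed
  for Fubini in the strong type bound.\<close>

lemma sigma_finite_lebesgue: "sigma_finite_measure (lebesgue :: 'a::euclidean_space measure)"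
proof
  obtain A :: "'a set set" where "countable A" "A \<subseteq> sets lborel" "\<Union>A = space lborel"
    "\<forall>a\<in>A. emeasure lborel a \<noteq> \<infinity>"
    using lborel.sigma_finite_countable by blast
  then show "\<exists>A::'a set set. countable A \<and> A \<subseteq> sets lebesgue \<and> \<Union> A = space lebesgue
      \<and> (\<forall>a\<in>A. emeasure lebesgue a \<noteq> \<infinity>)"
    by (intro exI[of _ A]) (auto simp: subset_eq)
qed

subsection \<open>The Hardy-Littlewood maximal theorem for cubes\<close>

text \<open>A cube witnessing the strict inequality can be enlarged by a small \<open>e\<close> on
  every side: the integral does not decrease, the volume varies continuously, and \<open>x\<close>
  becomes an interior point.\<close>

lemma less_maximalE:
  fixes f :: "real ^ 'n \<Rightarrow> real"
  assumes "t < maximal f x"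
  obtains a l where "0 < l" "x \<in> box a (a + vec l)"
    "t * ennreal (l ^ CARD('n)) < (\<integral>\<^sup>+ y \<in> cbox a (a + vec l). ennreal \<bar>f y\<bar> \<partial>lebesgue)"
proof -
  obtain a l where l: "0 < l" and x: "x \<in> cbox a (a + vec l)"
    and less: "t * ennreal (l ^ CARD('n)) < (\<integral>\<^sup>+ y \<in> cbox a (a + vec l). ennreal \<bar>f y\<bar> \<partial>lebesgue)"
      (is "_ < ?I")
    using assms unfolding not_le[symmetric] maximal_le_iff by auto
  obtain r where r: "t = ennreal r" "0 \<le> r"
    using assms by (cases t) auto
  have "((\<lambda>e. ennreal (r * (l + 2 * e) ^ CARD('n))) \<longlongrightarrow> ennreal (r * (l + 2 * 0) ^ CARD('n))) (at_right 0)"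
    by (intro tendsto_intros)
  moreover have "ennreal (r * (l + 2 * 0) ^ CARD('n)) < ?I"
    using less r l by (simp add: ennreal_mult)
  ultimately have "\<forall>\<^sub>F e in at_right 0. ennreal (r * (l + 2 * e) ^ CARD('n)) < ?I"
    by (rule order_tendstoD)
  moreover have "\<forall>\<^sub>F e in at_right (0::real). 0 < e"
    by (simp add: eventually_at_right_less)
  ultimately have "\<forall>\<^sub>F e in at_right (0::real). ennreal (r * (l + 2 * e) ^ CARD('n)) < ?I \<and> 0 < e"
    by (rule eventually_conj)
  then have "\<exists>e. ennreal (r * (l + 2 * e) ^ CARD('n)) < ?I \<and> 0 < e"
    by (rule eventually_happens'[OF trivial_limit_at_right_real])
  then obtain e where e: "0 < e" and less': "ennreal (r * (l + 2 * e) ^ CARD('n)) < ?I"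
    by blast
  have "cbox a (a + vec l) \<subseteq> cbox (a - vec e) (a - vec e + vec (l + 2 * e))"
    using e by (auto simp: mem_box_cart) (smt (verit))+
  then have "?I \<le> (\<integral>\<^sup>+ y \<in> cbox (a - vec e) (a - vec e + vec (l + 2 * e)). ennreal \<bar>f y\<bar> \<partial>lebesgue)"
    by (intro nn_integral_mono mult_left_mono) (auto simp: indicator_def)
  with less' have "t * ennreal ((l + 2 * e) ^ CARD('n))
      < (\<integral>\<^sup>+ y \<in> cbox (a - vec e) (a - vec e + vec (l + 2 * e)). ennreal \<bar>f y\<bar> \<partial>lebesgue)"
    using r l e by (simp add: ennreal_mult)
  moreover have "x \<in> box (a - vec e) (a - vec e + vec (l + 2 * e))"
    using x e by (auto simp: mem_box_cart) (smt (verit))+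
  ultimately show thesis
    using that[of "l + 2 * e" "a - vec e"] l e by simp
qed

text \<open>Lower semicontinuity of the maximal function: the cube that witnesses the inequality at
  an interior point witnesses it at all its other points too. Measurability follows.\<close>

lemma open_maximal_superlevel: "open {x. t < maximal f x}"
proof (rule openI)
  fix x assume "x \<in> {x. t < maximal f x}"
  then obtain a l where *: "0 < l" "x \<in> box a (a + vec l)"
    "t * ennreal (l ^ CARD('a)) < (\<integral>\<^sup>+ y \<in> cbox a (a + vec l). ennreal \<bar>f y\<bar> \<partial>lebesgue)"
    by (auto elim: less_maximalE)
  have "t < maximal f y" if "y \<in> box a (a + vec l)" for y
  proof (rule ccontr)
    assume "\<not> t < maximal f y"
    then have "maximal f y \<le> t"
      by simp
    then show False
      using *(1,3) that box_subset_cbox[of a "a + vec l"] unfolding maximal_le_iff by (meson not_le subsetD)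
  qed
  moreover obtain e where "0 < e" "ball x e \<subseteq> box a (a + vec l)"
    using *(2) open_box openE by blast
  ultimately show "\<exists>e>0. ball x e \<subseteq> {x. t < maximal f x}"
    by blast
qed

lemma maximal_superlevel_in_sets [simp]: "{x. t < maximal f x} \<in> sets lebesgue"
  by (simp add: borel_open open_maximal_superlevel)

lemma maximal_measurable [measurable]: "maximal f \<in> borel_measurable lebesgue"
proof -
  have "maximal f \<in> borel_measurable borel"
    by (rule borel_measurableI_greater) (auto intro: borel_open open_maximal_superlevel)
  then show ?thesis
    by (simp add: measurable_completion)
qed

text \<open>Greedy selection: keep a largest cube, discard all cubes that meet it, and recurse on
  the rest. A discarded cube is no larger than the kept one, so it lies in the concentric cube of
  three times the side.\<close>

lemma vitali_cubes:
  fixes S :: "((real ^ 'n) \<times> real) set"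
  assumes "finite S" "\<And>s. s \<in> S \<Longrightarrow> 0 < snd s"
  obtains D where "D \<subseteq> S" "disjoint_family_on (\<lambda>s. cbox (fst s) (fst s + vec (snd s))) D"
    "(\<Union>s\<in>S. cbox (fst s) (fst s + vec (snd s)))
       \<subseteq> (\<Union>s\<in>D. cbox (fst s - vec (snd s)) (fst s - vec (snd s) + vec (3 * snd s)))"
proof -
  let ?Q = "\<lambda>s :: (real ^ 'n) \<times> real. cbox (fst s) (fst s + vec (snd s))"
  let ?Q3 = "\<lambda>s :: (real ^ 'n) \<times> real. cbox (fst s - vec (snd s)) (fst s - vec (snd s) + vec (3 * snd s))"
  have "\<exists>D\<subseteq>S. disjoint_family_on ?Q D \<and> (\<Union>s\<in>S. ?Q s) \<subseteq> (\<Union>s\<in>D. ?Q3 s)"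
    using assms
  proof (induction S rule: finite_psubset_induct)
    case (psubset S)
    show ?case
    proof (cases "S = {}")
      case False
      obtain m where m: "m \<in> S" "\<And>s. s \<in> S \<Longrightarrow> snd s \<le> snd m"
        using False psubset.hyps Max_in[of "snd ` S"] Max_ge[of "snd ` S"] by fastforce
      \<comment> \<open>The cubes left for the recursion. \<open>m\<close> itself is not among them,
        since its cube is nonempty, so the set shrinks.\<close>
      define S' where "S' = {s \<in> S. ?Q s \<inter> ?Q m = {}}"
      have "fst m \<in> ?Q m"
        using m psubset.prems[of m] by (auto simp: mem_box_cart less_imp_le)
      then have "S' \<subset> S"
        using m by (auto simp: S'_def)
      with psubset obtain D where D: "D \<subseteq> S'" "disjoint_family_on ?Q D" "(\<Union>s\<in>S'. ?Q s) \<subseteq> (\<Union>s\<in>D. ?Q3 s)"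
        by (metis (no_types, lifting) psubsetD)
      have "disjoint_family_on ?Q (insert m D)"
        using D(1,2) by (auto simp: disjoint_family_on_def S'_def)
      \<comment> \<open>Through a common point \<open>z\<close>, each coordinate of a point of
        \<open>?Q s\<close> is within \<open>snd s\<close>, hence within \<open>snd m\<close>, of a
        coordinate of a point of \<open>?Q m\<close>.\<close>
      moreover have "?Q s \<subseteq> ?Q3 m" if s: "s \<in> S" "s \<notin> S'" for s
      proof
        fix x assume x: "x \<in> ?Q s"
        obtain z where z: "z \<in> ?Q s" "z \<in> ?Q m"
          using s by (auto simp: S'_def)
        show "x \<in> ?Q3 m"
          unfolding mem_box_cart
        proof
          fix i
          have "fst s $ i \<le> x $ i" "x $ i \<le> fst s $ i + snd s"
            "fst s $ i \<le> z $ i" "z $ i \<le> fst s $ i + snd s"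
            "fst m $ i \<le> z $ i" "z $ i \<le> fst m $ i + snd m"
            using x z by (simp_all add: mem_box_cart)
          with m(2)[OF s(1)]
          show "(fst m - vec (snd m)) $ i \<le> x $ i \<and> x $ i \<le> (fst m - vec (snd m) + vec (3 * snd m)) $ i"
            by simp
        qed
      qed
      then have "(\<Union>s\<in>S. ?Q s) \<subseteq> (\<Union>s\<in>insert m D. ?Q3 s)"
        using D(3) by blast
      ultimately show ?thesis
        using D(1) m(1) by (intro exI[of _ "insert m D"]) (auto simp: S'_def)
    qed (auto simp: disjoint_family_on_def)
  qed
  then show thesis
    using that by blast
qed

text \<open>Tripling costs the factor \<open>3 ^ CARD('n)\<close> in volume, and the integrals over
  the selected disjoint cubes add up to at most the whole integral.\<close>

lemma maximal_weak_type_finite: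
  fixes f :: "real ^ 'n \<Rightarrow> real" and S :: "((real ^ 'n) \<times> real) set"
  assumes [measurable]: "f \<in> borel_measurable lebesgue"
    and S: "finite S" "\<And>s. s \<in> S \<Longrightarrow> 0 < snd s" and r: "0 < r"
    and large: "\<And>s. s \<in> S \<Longrightarrow> ennreal (r * snd s ^ CARD('n))
          \<le> (\<integral>\<^sup>+ y \<in> cbox (fst s) (fst s + vec (snd s)). ennreal \<bar>f y\<bar> \<partial>lebesgue)"
  shows "ennreal r * emeasure lborel (\<Union>s\<in>S. cbox (fst s) (fst s + vec (snd s)))
    \<le> 3 ^ CARD('n) * (\<integral>\<^sup>+ y. ennreal \<bar>f y\<bar> \<partial>lebesgue)"
proof -
  let ?Q = "\<lambda>s :: (real ^ 'n) \<times> real. cbox (fst s) (fst s + vec (snd s))"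
  obtain D where D: "D \<subseteq> S" "disjoint_family_on ?Q D" "(\<Union>s\<in>S. ?Q s)
       \<subseteq> (\<Union>s\<in>D. cbox (fst s - vec (snd s)) (fst s - vec (snd s) + vec (3 * snd s)))"
    using vitali_cubes[OF S] by blast
  have fin: "finite D"
    using D S finite_subset by blast
  have pos: "0 < snd s" if "s \<in> D" for s
    using D S that by blast
  have "emeasure lborel (\<Union>s\<in>S. ?Q s)
      \<le> emeasure lborel (\<Union>s\<in>D. cbox (fst s - vec (snd s)) (fst s - vec (snd s) + vec (3 * snd s)))"
    using D(3) fin by (intro emeasure_mono) auto
  also have "\<dots> \<le> (\<Sum>s\<in>D. emeasure lborel (cbox (fst s - vec (snd s)) (fst s - vec (snd s) + vec (3 * snd s))))"
    using fin by (intro emeasure_subadditive_finite) auto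
  also have "\<dots> = (\<Sum>s\<in>D. ennreal (3 ^ CARD('n)) * ennreal (snd s ^ CARD('n)))"
    using pos by (intro sum.cong) (auto simp: emeasure_cube power_mult_distrib less_imp_le ennreal_mult)
  finally have "ennreal r * emeasure lborel (\<Union>s\<in>S. ?Q s)
      \<le> ennreal r * (\<Sum>s\<in>D. ennreal (3 ^ CARD('n)) * ennreal (snd s ^ CARD('n)))"
    by (rule mult_left_mono) simp
  also have "\<dots> = ennreal (3 ^ CARD('n)) * (\<Sum>s\<in>D. ennreal (r * snd s ^ CARD('n)))"
    using r pos by (auto simp: sum_distrib_left ennreal_mult less_imp_le mult_ac intro!: sum.cong)
  also have "\<dots> \<le> ennreal (3 ^ CARD('n)) * (\<Sum>s\<in>D. \<integral>\<^sup>+ y \<in> ?Q s. ennreal \<bar>f y\<bar> \<partial>lebesgue)"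
    using D large by (intro mult_left_mono sum_mono) auto
  also have "(\<Sum>s\<in>D. \<integral>\<^sup>+ y \<in> ?Q s. ennreal \<bar>f y\<bar> \<partial>lebesgue)
      = (\<integral>\<^sup>+ y. ennreal \<bar>f y\<bar> * (\<Sum>s\<in>D. indicator (?Q s) y) \<partial>lebesgue)"
    by (subst nn_integral_sum[symmetric]) (auto simp: sum_distrib_left)
  also have "\<dots> = (\<integral>\<^sup>+ y. ennreal \<bar>f y\<bar> * indicator (\<Union>s\<in>D. ?Q s) y \<partial>lebesgue)"
    by (subst indicator_UN_disjoint[OF fin D(2)]) simp
  also have "\<dots> \<le> (\<integral>\<^sup>+ y. ennreal \<bar>f y\<bar> \<partial>lebesgue)"
    by (intro nn_integral_mono) (auto simp: indicator_def)
  finally show ?thesis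
    by (simp add: ennreal_power[symmetric] mult_left_mono)
qed

text \<open>The interiors of the cubes with average at least \<open>r\<close> cover the superlevel
  set. Lindelof's theorem leaves countably many, and continuity of the measure along finite unions
  reduces to the finite case.\<close>

lemma maximal_weak_type:
  fixes f :: "real ^ 'n \<Rightarrow> real"
  assumes f: "f \<in> borel_measurable lebesgue" and r: "0 < r"
  shows "ennreal r * emeasure lebesgue {x. ennreal r < maximal f x}
    \<le> 3 ^ CARD('n) * (\<integral>\<^sup>+ y. ennreal \<bar>f y\<bar> \<partial>lebesgue)" (is "_ \<le> ?R")
proof -
  define B where "B s = box (fst s) (fst s + vec (snd s))" for s :: "(real ^ 'n) \<times> real"
  define G where "G = {s :: (real ^ 'n) \<times> real. 0 < snd s \<and> ennreal (r * snd s ^ CARD('n))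
          \<le> (\<integral>\<^sup>+ y \<in> cbox (fst s) (fst s + vec (snd s)). ennreal \<bar>f y\<bar> \<partial>lebesgue)}"
  have "x \<in> (\<Union>s\<in>G. B s)" if x: "ennreal r < maximal f x" for x
  proof -
    obtain a l where "0 < l" "x \<in> box a (a + vec l)" and
      "ennreal r * ennreal (l ^ CARD('n)) < (\<integral>\<^sup>+ y \<in> cbox a (a + vec l). ennreal \<bar>f y\<bar> \<partial>lebesgue)"
      using less_maximalE[OF x] by blast
    then have "(a, l) \<in> G" "x \<in> B (a, l)"
      using r by (auto simp: G_def B_def ennreal_mult)
    then show ?thesis
      by blast
  qed
  then have sub: "{x. ennreal r < maximal f x} \<subseteq> \<Union>(B ` G)"
    by blast
  have "\<And>X. X \<in> B ` G \<Longrightarrow> open X"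
    by (auto simp: B_def)
  from Lindelof[OF this] obtain F where F: "F \<subseteq> B ` G" "countable F" "\<Union>F = \<Union>(B ` G)"
    by metis
  then obtain G' where G': "countable G'" "G' \<subseteq> G" "F = B ` G'"
    by (metis countable_subset_image)
  show ?thesis
  proof (cases "G' = {}")
    case True
    with sub F G' have "{x. ennreal r < maximal f x} = {}"
      by auto
    then show ?thesis
      by (simp only: emeasure_empty) simp
  next
    case False
    \<comment> \<open>Finite unions along an enumeration of \<open>G'\<close>;
      \<open>from_nat_into\<close> enumerates only nonempty sets, hence the case
      distinction.\<close>
    define A where "A k = (\<Union>i<k. B (from_nat_into G' i))" for k :: nat
    have A_sets: "A k \<in> sets lborel" for k
      by (auto simp: A_def B_def)
    have inc: "incseq A"
      unfolding A_def by (intro incseq_SucI) (auto simp: less_Suc_eq)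
    have "\<Union>(B ` G) = (\<Union>k. A k)"
    proof -
      have "\<Union>(B ` G) = (\<Union>s\<in>range (from_nat_into G'). B s)"
        using F G' range_from_nat_into[OF False G'(1)] by simp
      also have "\<dots> = (\<Union>i. B (from_nat_into G' i))"
        by simp
      also have "\<dots> = (\<Union>k. A k)"
        unfolding A_def using lessI by blast
      finally show ?thesis .
    qed
    then have "emeasure lebesgue {x. ennreal r < maximal f x} \<le> emeasure lebesgue (\<Union>k. A k)"
      using sub A_sets by (intro emeasure_mono) auto
    also have "\<dots> = (SUP k. emeasure lborel (A k))"
      using SUP_emeasure_incseq[of A lborel] A_sets inc by (simp add: image_subset_iff)
    finally have "ennreal r * emeasure lebesgue {x. ennreal r < maximal f x}
        \<le> (SUP k. ennreal r * emeasure lborel (A k))"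
      by (simp add: SUP_mult_left_ennreal[symmetric] mult_left_mono)
    also have "\<dots> \<le> ?R"
    proof (rule SUP_least)
      fix k
      let ?S = "from_nat_into G' ` {..<k}"
      have S: "?S \<subseteq> G"
        using from_nat_into[OF False] G' by auto
      have "emeasure lborel (A k) \<le> emeasure lborel (\<Union>s\<in>?S. cbox (fst s) (fst s + vec (snd s)))"
      proof (rule emeasure_mono)
        show "A k \<subseteq> (\<Union>s\<in>?S. cbox (fst s) (fst s + vec (snd s)))"
          unfolding A_def B_def image_image using box_subset_cbox by (intro UN_mono) auto
        show "(\<Union>s\<in>?S. cbox (fst s) (fst s + vec (snd s))) \<in> sets lborel"
          by (intro sets.finite_UN) auto
      qed
      then have "ennreal r * emeasure lborel (A k)
          \<le> ennreal r * emeasure lborel (\<Union>s\<in>?S. cbox (fst s) (fst s + vec (snd s)))"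
        by (rule mult_left_mono) simp
      also have "\<dots> \<le> ?R"
        using S by (intro maximal_weak_type_finite f r) (auto simp: G_def)
      finally show "ennreal r * emeasure lborel (A k) \<le> ?R" .
    qed
    finally show ?thesis .
  qed
qed

section \<open>The strong type bound, by integrating the weak type bound over all levels\<close>

lemma nn_integral_powr_from_0:
  assumes "-1 < s" "0 \<le> c"
  shows "(\<integral>\<^sup>+ t. (if 0 < t \<and> t < c then ennreal (t powr s) else 0) \<partial>lborel)
    = ennreal (c powr (s + 1) / (s + 1))"
proof -
  have "((\<lambda>t. t powr s) has_integral (c powr (s + 1) / (s + 1))) {0<..<c}"
    using has_integral_powr_from_0[OF assms] by (simp add: has_integral_Icc_iff_Ioo)
  then have "(\<integral>\<^sup>+ t. ennreal (t powr s) * indicator {0<..<c} t \<partial>lborel) = ennreal (c powr (s + 1) / (s + 1))"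
    by (intro nn_integral_has_integral_lebesgue') auto
  moreover have "(\<integral>\<^sup>+ t. (if 0 < t \<and> t < c then ennreal (t powr s) else 0) \<partial>lborel)
      = (\<integral>\<^sup>+ t. ennreal (t powr s) * indicator {0<..<c} t \<partial>lborel)"
    by (intro nn_integral_cong) (auto simp: indicator_def)
  ultimately show ?thesis
    by simp
qed

text \<open>For finite \<open>u\<close> this is the integral of the derivative of
  \<open>t powr p\<close> from 0 to \<open>u\<close>. For infinite \<open>u\<close> both sides are
  infinite, since the right side exceeds its value at every finite \<open>u\<close>.\<close>

lemma ennpow_layer_cake:
  assumes p: "0 < p"
  shows "ennpow u p = (\<integral>\<^sup>+ t. (if 0 < t \<and> ennreal t < u then ennreal (p * t powr (p - 1)) else 0) \<partial>lborel)"
    (is "_ = ?I u")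
proof -
  have real: "?I (ennreal c) = ennreal (c powr p)" if "0 \<le> c" for c
  proof -
    have "?I (ennreal c) = (\<integral>\<^sup>+ t. ennreal p * (if 0 < t \<and> t < c then ennreal (t powr (p - 1)) else 0) \<partial>lborel)"
      using p that by (intro nn_integral_cong) (auto simp: ennreal_mult ennreal_less_iff)
    also have "\<dots> = ennreal p * ennreal (c powr p / p)"
      using nn_integral_powr_from_0[of "p - 1" c] p that by (subst nn_integral_cmult) auto
    also have "\<dots> = ennreal (c powr p)"
      using p by (subst ennreal_mult[symmetric]) auto
    finally show ?thesis .
  qed
  show ?thesis
  proof (cases u)
    case top
    have "?I top = top"
    proof (rule ccontr)
      assume "?I top \<noteq> top"
      then obtain c where c: "?I top = ennreal c" "0 \<le> c"
        by (cases "?I top") auto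
      \<comment> \<open>This level is chosen to make the left side equal to \<open>c + 1\<close>,
        more than the supposed value \<open>c\<close>.\<close>
      have "?I (ennreal ((c + 1) powr (1 / p))) \<le> ?I top"
        by (intro nn_integral_mono) auto
      then show False
        using c p by (simp add: real powr_powr)
    qed
    then show ?thesis
      using top by simp
  qed (simp add: real ennpow_ennreal)
qed

text \<open>The weak type bound, applied to the part of \<open>f\<close> where \<open>\<bar>f\<bar> > t / 2\<close>; the rest
  contributes at most \<open>t / 2\<close> to the maximal function.\<close>

lemma maximal_superlevel_le:
  fixes f :: "real ^ 'n \<Rightarrow> real"
  assumes [measurable]: "f \<in> borel_measurable lebesgue" and t: "0 < t"
  shows "ennreal (t / 2) * emeasure lebesgue {x. ennreal t < maximal f x}
    \<le> 3 ^ CARD('n) * (\<integral>\<^sup>+ x. (if t < 2 * \<bar>f x\<bar> then ennreal \<bar>f x\<bar> else 0) \<partial>lebesgue)"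
proof -
  define g where "g x = (if t < 2 * \<bar>f x\<bar> then f x else 0)" for x
  have [measurable]: "g \<in> borel_measurable lebesgue"
    unfolding g_def by measurable
  have le: "maximal f x \<le> maximal g x + ennreal (t / 2)" for x
    unfolding maximal_le_iff
  proof (intro allI impI)
    fix a :: "real ^ 'n" and l :: real assume Q: "0 < l" "x \<in> cbox a (a + vec l)"
    let ?Q = "cbox a (a + vec l)"
    have "(\<integral>\<^sup>+ y \<in> ?Q. ennreal \<bar>f y\<bar> \<partial>lebesgue)
        \<le> (\<integral>\<^sup>+ y. ennreal \<bar>g y\<bar> * indicator ?Q y + ennreal (t / 2) * indicator ?Q y \<partial>lebesgue)"
      using t by (intro nn_integral_mono) (auto simp: g_def indicator_def intro: ennreal_leI)
    also have "\<dots> = (\<integral>\<^sup>+ y \<in> ?Q. ennreal \<bar>g y\<bar> \<partial>lebesgue) + ennreal (t / 2) * ennreal (l ^ CARD('n))"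
      using Q by (subst nn_integral_add) (auto simp: nn_integral_cmult_indicator emeasure_cube)
    also have "\<dots> \<le> maximal g x * ennreal (l ^ CARD('n)) + ennreal (t / 2) * ennreal (l ^ CARD('n))"
      using Q by (intro add_right_mono nn_integral_cube_le_maximal)
    finally show "(\<integral>\<^sup>+ y \<in> ?Q. ennreal \<bar>f y\<bar> \<partial>lebesgue) \<le> (maximal g x + ennreal (t / 2)) * ennreal (l ^ CARD('n))"
      by (simp add: distrib_right)
  qed
  have "ennreal (t / 2) < maximal g x" if "ennreal t < maximal f x" for x
  proof (rule ccontr)
    assume "\<not> ennreal (t / 2) < maximal g x"
    then have "maximal g x + ennreal (t / 2) \<le> ennreal (t / 2) + ennreal (t / 2)"
      by (intro add_right_mono) simp
    also have "\<dots> = ennreal t"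
      using t by (subst ennreal_plus[symmetric]) auto
    finally show False
      using le[of x] that by simp
  qed
  then have "ennreal (t / 2) * emeasure lebesgue {x. ennreal t < maximal f x}
      \<le> ennreal (t / 2) * emeasure lebesgue {x. ennreal (t / 2) < maximal g x}"
    by (intro mult_left_mono emeasure_mono) auto
  also have "\<dots> \<le> 3 ^ CARD('n) * (\<integral>\<^sup>+ x. ennreal \<bar>g x\<bar> \<partial>lebesgue)"
    using t by (intro maximal_weak_type) auto
  also have "(\<integral>\<^sup>+ x. ennreal \<bar>g x\<bar> \<partial>lebesgue) = (\<integral>\<^sup>+ x. (if t < 2 * \<bar>f x\<bar> then ennreal \<bar>f x\<bar> else 0) \<partial>lebesgue)"
    by (intro nn_integral_cong) (simp add: g_def)
  finally show ?thesis .
qed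

text \<open>Marcinkiewicz interpolation: write the power as an integral over levels
  \<open>t\<close>, exchange integrals, apply the weak type bound at each level, and exchange back.
  For fixed \<open>x\<close> the remaining integral of \<open>t powr (p - 2)\<close> runs up to
  \<open>2 * \<bar>f x\<bar>\<close> and converges at 0 because \<open>p > 1\<close>.\<close>

lemma maximal_strong_type:
  fixes f :: "real ^ 'n \<Rightarrow> real"
  assumes [measurable]: "f \<in> borel_measurable lebesgue" and p: "1 < p"
  shows "(\<integral>\<^sup>+ x. ennpow (maximal f x) p \<partial>lebesgue)
    \<le> ennreal (2 powr p * 3 ^ CARD('n) * p / (p - 1)) * (\<integral>\<^sup>+ x. ennpow (ennreal \<bar>f x\<bar>) p \<partial>lebesgue)"
proof -
  interpret pair_sigma_finite "lebesgue :: (real ^ 'n) measure" "lborel :: real measure"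
    using sigma_finite_lebesgue sigma_finite_lborel by (simp add: pair_sigma_finite_def)
  have "(\<integral>\<^sup>+ x. ennpow (maximal f x) p \<partial>lebesgue)
     = (\<integral>\<^sup>+ x. \<integral>\<^sup>+ t. (if 0 < t \<and> ennreal t < maximal f x then ennreal (p * t powr (p - 1)) else 0) \<partial>lborel \<partial>lebesgue)"
    using p by (intro nn_integral_cong ennpow_layer_cake) simp
  also have "\<dots> = (\<integral>\<^sup>+ t. \<integral>\<^sup>+ x. (if 0 < t \<and> ennreal t < maximal f x then ennreal (p * t powr (p - 1)) else 0) \<partial>lebesgue \<partial>lborel)"
    by (rule Fubini'[symmetric]) measurable
  also have "\<dots> \<le> (\<integral>\<^sup>+ t. \<integral>\<^sup>+ x. ennreal (2 * 3 ^ CARD('n) * p) *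
      (if 0 < t \<and> t < 2 * \<bar>f x\<bar> then ennreal (t powr (p - 2)) * ennreal \<bar>f x\<bar> else 0) \<partial>lebesgue \<partial>lborel)"
  proof (rule nn_integral_mono)
    fix t :: real
    show "(\<integral>\<^sup>+ x. (if 0 < t \<and> ennreal t < maximal f x then ennreal (p * t powr (p - 1)) else 0) \<partial>lebesgue)
      \<le> (\<integral>\<^sup>+ x. ennreal (2 * 3 ^ CARD('n) * p) *
        (if 0 < t \<and> t < 2 * \<bar>f x\<bar> then ennreal (t powr (p - 2)) * ennreal \<bar>f x\<bar> else 0) \<partial>lebesgue)"
    proof (cases "0 < t")
      case True
      \<comment> \<open>Splits off the factor \<open>t / 2\<close> that
        \<open>maximal_superlevel_le\<close> absorbs.\<close>
      have factor: "ennreal (p * t powr (p - 1)) = ennreal (2 * p * t powr (p - 2)) * ennreal (t / 2)"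
        using True p powr_add[of t "p - 2" 1] by (subst ennreal_mult[symmetric]) auto
      have "(\<integral>\<^sup>+ x. (if 0 < t \<and> ennreal t < maximal f x then ennreal (p * t powr (p - 1)) else 0) \<partial>lebesgue)
          = (\<integral>\<^sup>+ x. ennreal (p * t powr (p - 1)) * indicator {x. ennreal t < maximal f x} x \<partial>lebesgue)"
        using True by (intro nn_integral_cong) (auto simp: indicator_def)
      also have "\<dots> = ennreal (p * t powr (p - 1)) * emeasure lebesgue {x. ennreal t < maximal f x}"
        by (intro nn_integral_cmult_indicator) simp
      also have "\<dots> \<le> ennreal (2 * p * t powr (p - 2)) * (3 ^ CARD('n) * (\<integral>\<^sup>+ x. (if t < 2 * \<bar>f x\<bar> then ennreal \<bar>f x\<bar> else 0) \<partial>lebesgue))"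
        unfolding factor mult.assoc using True by (intro mult_left_mono maximal_superlevel_le) auto
      also have "\<dots> = ennreal (2 * 3 ^ CARD('n) * p) * (ennreal (t powr (p - 2)) *
          (\<integral>\<^sup>+ x. (if t < 2 * \<bar>f x\<bar> then ennreal \<bar>f x\<bar> else 0) \<partial>lebesgue))"
        using p by (simp add: ennreal_mult ennreal_power[symmetric] mult_ac)
      also have "\<dots> = (\<integral>\<^sup>+ x. ennreal (2 * 3 ^ CARD('n) * p) * (ennreal (t powr (p - 2)) *
          (if t < 2 * \<bar>f x\<bar> then ennreal \<bar>f x\<bar> else 0)) \<partial>lebesgue)"
        by (simp add: nn_integral_cmult)
      also have "\<dots> = (\<integral>\<^sup>+ x. ennreal (2 * 3 ^ CARD('n) * p) *
          (if 0 < t \<and> t < 2 * \<bar>f x\<bar> then ennreal (t powr (p - 2)) * ennreal \<bar>f x\<bar> else 0) \<partial>lebesgue)"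
        using True by (intro nn_integral_cong) auto
      finally show ?thesis .
    qed simp
  qed
  also have "\<dots> = (\<integral>\<^sup>+ x. \<integral>\<^sup>+ t. ennreal (2 * 3 ^ CARD('n) * p) *
      (if 0 < t \<and> t < 2 * \<bar>f x\<bar> then ennreal (t powr (p - 2)) * ennreal \<bar>f x\<bar> else 0) \<partial>lborel \<partial>lebesgue)"
    by (rule Fubini') measurable
  also have "\<dots> = (\<integral>\<^sup>+ x. ennreal (2 powr p * 3 ^ CARD('n) * p / (p - 1)) * ennpow (ennreal \<bar>f x\<bar>) p \<partial>lebesgue)"
  proof (rule nn_integral_cong)
    fix x
    have "(\<integral>\<^sup>+ t. ennreal (2 * 3 ^ CARD('n) * p) *
        (if 0 < t \<and> t < 2 * \<bar>f x\<bar> then ennreal (t powr (p - 2)) * ennreal \<bar>f x\<bar> else 0) \<partial>lborel)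
      = (\<integral>\<^sup>+ t. (ennreal (2 * 3 ^ CARD('n) * p) * ennreal \<bar>f x\<bar>) *
          (if 0 < t \<and> t < 2 * \<bar>f x\<bar> then ennreal (t powr (p - 2)) else 0) \<partial>lborel)"
      by (intro nn_integral_cong) (auto simp: mult_ac)
    also have "\<dots> = (ennreal (2 * 3 ^ CARD('n) * p) * ennreal \<bar>f x\<bar>) * ennreal ((2 * \<bar>f x\<bar>) powr (p - 1) / (p - 1))"
      using nn_integral_powr_from_0[of "p - 2" "2 * \<bar>f x\<bar>"] p by (subst nn_integral_cmult) auto
    also have "\<dots> = ennreal (2 * 3 ^ CARD('n) * p * \<bar>f x\<bar> * ((2 * \<bar>f x\<bar>) powr (p - 1) / (p - 1)))"
      using p by (simp add: ennreal_mult[symmetric] del: ennreal_mult'')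
    also have "2 * 3 ^ CARD('n) * p * \<bar>f x\<bar> * ((2 * \<bar>f x\<bar>) powr (p - 1) / (p - 1))
        = (2 powr p * 3 ^ CARD('n) * p / (p - 1)) * \<bar>f x\<bar> powr p"
    proof -
      have "(2 * \<bar>f x\<bar>) powr p = (2 * \<bar>f x\<bar>) * (2 * \<bar>f x\<bar>) powr (p - 1)"
        using powr_mult_base[of "2 * \<bar>f x\<bar>" "p - 1"] by simp
      then show ?thesis
        by (simp add: powr_mult field_simps)
    qed
    also have "ennreal \<dots> = ennreal (2 powr p * 3 ^ CARD('n) * p / (p - 1)) * ennpow (ennreal \<bar>f x\<bar>) p"
      using p by (subst ennreal_mult) (auto simp: ennpow_ennreal)
    finally show "(\<integral>\<^sup>+ t. ennreal (2 * 3 ^ CARD('n) * p) *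
        (if 0 < t \<and> t < 2 * \<bar>f x\<bar> then ennreal (t powr (p - 2)) * ennreal \<bar>f x\<bar> else 0) \<partial>lborel)
      = ennreal (2 powr p * 3 ^ CARD('n) * p / (p - 1)) * ennpow (ennreal \<bar>f x\<bar>) p" .
  qed
  also have "\<dots> = ennreal (2 powr p * 3 ^ CARD('n) * p / (p - 1)) * (\<integral>\<^sup>+ x. ennpow (ennreal \<bar>f x\<bar>) p \<partial>lebesgue)"
    by (intro nn_integral_cmult) measurable
  finally show ?thesis .
qed

subsection \<open>The commutator of a Lipschitz function\<close>

text \<open>Hedberg's inequality: with \<open>\<theta> = \<beta> p / n\<close>, split the average of \<open>\<bar>f\<bar>\<close> as
  \<open>A = A\<^bsup>\<theta>\<^esup> A\<^bsup>1-\<theta>\<^esup>\<close> and bound the first factor by the norm, the second by the maximal function.\<close>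

lemma fractional_average_le:
  fixes f :: "real ^ 'n \<Rightarrow> real"
  assumes [measurable]: "f \<in> borel_measurable lebesgue"
    and \<beta>: "0 < \<beta>" and p: "1 < p" "p < real CARD('n) / \<beta>" and T: "0 < T"
    and f: "(\<integral>\<^sup>+ x. ennpow (ennreal \<bar>f x\<bar>) p \<partial>lebesgue) \<le> ennreal (T powr p)"
    and l: "0 < l" and x: "x \<in> cbox a (a + vec l)"
  shows "ennreal (l powr \<beta>) * (\<integral>\<^sup>+ y \<in> cbox a (a + vec l). ennreal \<bar>f y\<bar> \<partial>lebesgue)
    \<le> ennreal ((2 * T) powr (\<beta> * p / real CARD('n)))
        * ennpow (maximal f x) (1 - \<beta> * p / real CARD('n)) * ennreal (l ^ CARD('n))"
proof -
  let ?n = "real CARD('n)"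
  let ?I = "\<integral>\<^sup>+ y \<in> cbox a (a + vec l). ennreal \<bar>f y\<bar> \<partial>lebesgue"
  define \<theta> where "\<theta> = \<beta> * p / ?n"
  have \<theta>: "0 < \<theta>" "\<theta> < 1"
    using \<beta> p by (auto simp: \<theta>_def field_simps)
  \<comment> \<open>Chosen so that \<open>S powr p * l ^ CARD('n) = T powr p\<close>; then the
    average of \<open>\<bar>f\<bar>\<close> is at most \<open>2 * S\<close>, which is Hoelder's
    bound up to the factor 2.\<close>
  define S where "S = T * l powr (- ?n / p)"
  have S: "0 < S"
    using T l by (simp add: S_def)
  have "S powr p = T powr p * l powr (- ?n)"
    using T l p by (simp add: S_def powr_mult powr_powr)
  then have "S powr p * l ^ CARD('n) = T powr p"
    using l by (simp add: powr_minus powr_realpow)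
  moreover have "(\<integral>\<^sup>+ x \<in> cbox a (a + vec l). ennpow (ennreal \<bar>f x\<bar>) p \<partial>lebesgue)
      \<le> (\<integral>\<^sup>+ x. ennpow (ennreal \<bar>f x\<bar>) p \<partial>lebesgue)"
    by (intro nn_integral_mono) (auto simp: indicator_def)
  ultimately have I_le: "?I \<le> ennreal (2 * S * l ^ CARD('n))"
    using f p l S by (intro nn_integral_cube_le_of_ennpow[where p = p]) auto
  then obtain i where i: "?I = ennreal i" "0 \<le> i"
    by (cases ?I) (auto simp: top_unique)
  define A where "A = i / l ^ CARD('n)"
  have A: "0 \<le> A" "?I = ennreal (A * l ^ CARD('n))"
    using i l by (simp_all add: A_def)
  have A_le: "A \<le> 2 * S"
    using I_le i l S by (simp add: A_def pos_divide_le_eq)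
  have A_max: "ennreal A \<le> maximal f x"
    using nn_integral_cube_le_maximal[OF l x, of f] A(1) l unfolding A(2)
    by (cases "maximal f x") (auto simp: ennreal_mult[symmetric] simp del: ennreal_mult'')
  have "l powr \<beta> * A = l powr \<beta> * A powr \<theta> * A powr (1 - \<theta>)"
    using A(1) by (simp add: powr_add[symmetric])
  also have "\<dots> \<le> l powr \<beta> * (2 * S) powr \<theta> * A powr (1 - \<theta>)"
    using A(1) A_le \<theta> by (intro mult_right_mono mult_left_mono powr_mono2) auto
  also have "l powr \<beta> * (2 * S) powr \<theta> = (2 * T) powr \<theta>"
  proof -
    \<comment> \<open>This cancellation of the powers of \<open>l\<close> dictates the value of
      \<theta>.\<close>
    have "\<beta> + (- ?n / p) * \<theta> = 0"
      using p by (simp add: \<theta>_def)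
    then have "l powr \<beta> * (l powr (- ?n / p)) powr \<theta> = 1"
      using l unfolding powr_powr by (simp add: powr_add[symmetric])
    then show ?thesis
      using T by (simp add: S_def powr_mult mult_ac)
  qed
  finally have "l powr \<beta> * A * l ^ CARD('n) \<le> (2 * T) powr \<theta> * A powr (1 - \<theta>) * l ^ CARD('n)"
    using l by (intro mult_right_mono) auto
  then have "ennreal (l powr \<beta> * A * l ^ CARD('n)) \<le> ennreal ((2 * T) powr \<theta> * A powr (1 - \<theta>) * l ^ CARD('n))"
    by (rule ennreal_leI)
  moreover have "ennreal (l powr \<beta> * A * l ^ CARD('n)) = ennreal (l powr \<beta>) * ?I"
    using A l by (simp add: ennreal_mult mult.assoc)
  moreover have "ennreal ((2 * T) powr \<theta> * A powr (1 - \<theta>) * l ^ CARD('n))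
      = ennreal ((2 * T) powr \<theta>) * ennpow (ennreal A) (1 - \<theta>) * ennreal (l ^ CARD('n))"
    using A(1) l by (simp add: ennreal_mult ennpow_ennreal)
  moreover have "\<dots> \<le> ennreal ((2 * T) powr \<theta>) * ennpow (maximal f x) (1 - \<theta>) * ennreal (l ^ CARD('n))"
    using A_max \<theta> by (intro mult_left_mono mult_right_mono ennpow_mono) auto
  ultimately show ?thesis
    by (simp add: \<theta>_def)
qed

text \<open>On a cube of side \<open>l\<close> through \<open>x\<close>, replacing
  \<open>\<bar>b y\<bar>\<close> by the constant \<open>b x\<close> changes the integral of
  \<open>\<bar>b y * f y\<bar>\<close> by at most a multiple of \<open>l powr \<beta>\<close> times
  the integral of \<open>\<bar>f\<bar>\<close>. The number \<open>N\<close> stands for a bound on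
  the fractional maximal function at \<open>x\<close>. The hypothesis involves
  \<open>\<bar>b y\<bar>\<close> since that is all the maximal function of the product sees.\<close>

lemma commutator_pointwise_le:
  fixes b f :: "real ^ 'n \<Rightarrow> real"
  assumes [measurable]: "b \<in> borel_measurable lebesgue" "f \<in> borel_measurable lebesgue"
    and \<beta>: "0 < \<beta>" and K: "0 \<le> K" and bx: "0 \<le> b x"
    and lip: "AE y in lebesgue. \<bar>b x - \<bar>b y\<bar>\<bar> \<le> K * norm (x - y) powr \<beta>"
    and finite: "maximal f x < \<infinity>"
    and N: "\<And>a l. 0 < l \<Longrightarrow> x \<in> cbox a (a + vec l) \<Longrightarrow>
      ennreal (l powr \<beta>) * (\<integral>\<^sup>+ y \<in> cbox a (a + vec l). ennreal \<bar>f y\<bar> \<partial>lebesgue) \<le> N * ennreal (l ^ CARD('n))"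
  shows "commutator_defined_at b f x"
    and "e2ennreal \<bar>commutator b f x\<bar> \<le> ennreal (K * real CARD('n) powr \<beta>) * N"
proof -
  let ?M = "maximal f x" and ?Mb = "maximal (\<lambda>y. b y * f y) x"
  define E where "E = ennreal (K * real CARD('n) powr \<beta>)"
  have osc: "AE y in lebesgue. y \<in> cbox a (a + vec l) \<longrightarrow>
      \<bar>b x - \<bar>b y\<bar>\<bar> \<le> K * real CARD('n) powr \<beta> * l powr \<beta>"
    if Q: "0 < l" "x \<in> cbox a (a + vec l)" for a l
    using lip
  proof eventually_elim
    case (elim y)
    show ?case
    proof
      assume "y \<in> cbox a (a + vec l)"
      then have "K * norm (x - y) powr \<beta> \<le> K * (real CARD('n) powr \<beta> * l powr \<beta>)"
        using Q \<beta> K by (intro mult_left_mono norm_powr_le_cube) auto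
      with elim show "\<bar>b x - \<bar>b y\<bar>\<bar> \<le> K * real CARD('n) powr \<beta> * l powr \<beta>"
        by (simp add: mult.assoc)
    qed
  qed
  have term_E: "(\<integral>\<^sup>+ y \<in> cbox a (a + vec l). ennreal (K * real CARD('n) powr \<beta> * l powr \<beta>) * ennreal \<bar>f y\<bar> \<partial>lebesgue)
      \<le> E * N * ennreal (l ^ CARD('n))" if Q: "0 < l" "x \<in> cbox a (a + vec l)" for a l
  proof -
    have "(\<integral>\<^sup>+ y \<in> cbox a (a + vec l). ennreal (K * real CARD('n) powr \<beta> * l powr \<beta>) * ennreal \<bar>f y\<bar> \<partial>lebesgue)
        = E * (ennreal (l powr \<beta>) * (\<integral>\<^sup>+ y \<in> cbox a (a + vec l). ennreal \<bar>f y\<bar> \<partial>lebesgue))"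
      using K by (simp add: E_def ennreal_mult mult.assoc nn_integral_cmult)
    also have "\<dots> \<le> E * (N * ennreal (l ^ CARD('n)))"
      using N[OF Q] by (rule mult_left_mono) simp
    finally show ?thesis
      by (simp add: mult.assoc)
  qed
  have upper: "?Mb \<le> ennreal (b x) * ?M + E * N"
    unfolding maximal_le_iff
  proof (intro allI impI)
    fix a l assume Q: "0 < l" "x \<in> cbox a (a + vec l)"
    let ?Q = "cbox a (a + vec l)" and ?D = "K * real CARD('n) powr \<beta> * l powr \<beta>"
    have "(\<integral>\<^sup>+ y \<in> ?Q. ennreal \<bar>b y * f y\<bar> \<partial>lebesgue)
        \<le> (\<integral>\<^sup>+ y. ennreal (b x) * (ennreal \<bar>f y\<bar> * indicator ?Q y)
              + ennreal ?D * ennreal \<bar>f y\<bar> * indicator ?Q y \<partial>lebesgue)"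
    proof (rule nn_integral_mono_AE)
      show "AE y in lebesgue. ennreal \<bar>b y * f y\<bar> * indicator ?Q y
          \<le> ennreal (b x) * (ennreal \<bar>f y\<bar> * indicator ?Q y) + ennreal ?D * ennreal \<bar>f y\<bar> * indicator ?Q y"
        using osc[OF Q]
      proof eventually_elim
        case (elim y)
        have "\<bar>b y * f y\<bar> \<le> b x * \<bar>f y\<bar> + ?D * \<bar>f y\<bar>" if "y \<in> ?Q"
          unfolding abs_mult distrib_right[symmetric] using elim that by (intro mult_right_mono) auto
        then show ?case
          using bx K by (auto simp: indicator_def ennreal_mult[symmetric] ennreal_plus[symmetric]
            simp del: ennreal_plus ennreal_mult'' intro!: ennreal_leI)
      qed
    qed
    also have "\<dots> = ennreal (b x) * (\<integral>\<^sup>+ y \<in> ?Q. ennreal \<bar>f y\<bar> \<partial>lebesgue)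
        + (\<integral>\<^sup>+ y \<in> ?Q. ennreal ?D * ennreal \<bar>f y\<bar> \<partial>lebesgue)"
      by (subst nn_integral_add) (auto simp: nn_integral_cmult)
    also have "\<dots> \<le> ennreal (b x) * (?M * ennreal (l ^ CARD('n))) + E * N * ennreal (l ^ CARD('n))"
      using Q by (intro add_mono mult_left_mono nn_integral_cube_le_maximal term_E) auto
    finally show "(\<integral>\<^sup>+ y \<in> ?Q. ennreal \<bar>b y * f y\<bar> \<partial>lebesgue)
        \<le> (ennreal (b x) * ?M + E * N) * ennreal (l ^ CARD('n))"
      by (simp add: distrib_right mult.assoc)
  qed
  \<comment> \<open>For positive \<open>b x\<close> the factor is moved to the other side, so that
    the claim becomes a bound on \<open>?M\<close> alone and can be checked on cubes.\<close>
  have lower: "ennreal (b x) * ?M \<le> ?Mb + E * N"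
  proof (cases "b x = 0")
    case False
    with bx have pos: "0 < b x"
      by simp
    have inv: "ennreal (b x) * ennreal (1 / b x) = 1"
      using pos by (simp add: ennreal_mult[symmetric] del: ennreal_mult'')
    have "?M \<le> ennreal (1 / b x) * (?Mb + E * N)"
      unfolding maximal_le_iff
    proof (intro allI impI)
      fix a l assume Q: "0 < l" "x \<in> cbox a (a + vec l)"
      let ?Q = "cbox a (a + vec l)" and ?D = "K * real CARD('n) powr \<beta> * l powr \<beta>"
      have "ennreal (b x) * (\<integral>\<^sup>+ y \<in> ?Q. ennreal \<bar>f y\<bar> \<partial>lebesgue)
          = (\<integral>\<^sup>+ y. ennreal (b x) * (ennreal \<bar>f y\<bar> * indicator ?Q y) \<partial>lebesgue)"
        by (simp add: nn_integral_cmult)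
      also have "\<dots> \<le> (\<integral>\<^sup>+ y. ennreal \<bar>b y * f y\<bar> * indicator ?Q y
                + ennreal ?D * ennreal \<bar>f y\<bar> * indicator ?Q y \<partial>lebesgue)"
      proof (rule nn_integral_mono_AE)
        show "AE y in lebesgue. ennreal (b x) * (ennreal \<bar>f y\<bar> * indicator ?Q y)
            \<le> ennreal \<bar>b y * f y\<bar> * indicator ?Q y + ennreal ?D * ennreal \<bar>f y\<bar> * indicator ?Q y"
          using osc[OF Q]
        proof eventually_elim
          case (elim y)
          have "b x * \<bar>f y\<bar> \<le> \<bar>b y * f y\<bar> + ?D * \<bar>f y\<bar>" if "y \<in> ?Q"
            unfolding abs_mult distrib_right[symmetric] using elim that by (intro mult_right_mono) auto
          then show ?case
            using bx K by (auto simp: indicator_def ennreal_mult[symmetric] ennreal_plus[symmetric]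
              simp del: ennreal_plus ennreal_mult'' intro!: ennreal_leI)
        qed
      qed
      also have "\<dots> = (\<integral>\<^sup>+ y \<in> ?Q. ennreal \<bar>b y * f y\<bar> \<partial>lebesgue)
          + (\<integral>\<^sup>+ y \<in> ?Q. ennreal ?D * ennreal \<bar>f y\<bar> \<partial>lebesgue)"
        by (subst nn_integral_add) auto
      also have "\<dots> \<le> ?Mb * ennreal (l ^ CARD('n)) + E * N * ennreal (l ^ CARD('n))"
        using Q by (intro add_mono nn_integral_cube_le_maximal term_E)
      finally have "ennreal (1 / b x) * (ennreal (b x) * (\<integral>\<^sup>+ y \<in> ?Q. ennreal \<bar>f y\<bar> \<partial>lebesgue))
          \<le> ennreal (1 / b x) * ((?Mb + E * N) * ennreal (l ^ CARD('n)))"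
        unfolding distrib_right by (rule mult_left_mono) simp
      moreover have "ennreal (1 / b x) * (ennreal (b x) * (\<integral>\<^sup>+ y \<in> ?Q. ennreal \<bar>f y\<bar> \<partial>lebesgue))
          = (\<integral>\<^sup>+ y \<in> ?Q. ennreal \<bar>f y\<bar> \<partial>lebesgue)"
        using inv by (simp add: mult.assoc[symmetric] mult.commute[of "ennreal (1 / b x)"])
      ultimately show "(\<integral>\<^sup>+ y \<in> ?Q. ennreal \<bar>f y\<bar> \<partial>lebesgue)
          \<le> ennreal (1 / b x) * (?Mb + E * N) * ennreal (l ^ CARD('n))"
        by (simp only: mult.assoc)
    qed
    then have "ennreal (b x) * ?M \<le> ennreal (b x) * (ennreal (1 / b x) * (?Mb + E * N))"
      by (rule mult_left_mono) simp
    then show ?thesis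
      using inv by (simp add: mult.assoc[symmetric])
  qed simp
  obtain m where m: "?M = ennreal m" "0 \<le> m"
    using finite by (cases ?M) auto
  show "commutator_defined_at b f x"
    using m by (simp add: commutator_defined_at_def)
  have "e2ennreal \<bar>commutator b f x\<bar> \<le> E * N"
  \<comment> \<open>If \<open>E * N\<close> is infinite the bound is trivial. Otherwise
    \<open>upper\<close> makes \<open>?Mb\<close> finite, and the commutator is an honest difference
    of reals.\<close>
  proof (cases "E * N")
    case (real k)
    then have "?Mb < \<infinity>"
      using upper m bx by (auto simp: ennreal_mult[symmetric] ennreal_plus[symmetric]
        simp del: ennreal_plus ennreal_mult'' intro: le_less_trans)
    then obtain w where w: "?Mb = ennreal w" "0 \<le> w"
      by (cases ?Mb) auto
    have "w \<le> b x * m + k" "b x * m \<le> w + k"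
      using upper lower m w real bx by (simp_all add: ennreal_mult[symmetric] ennreal_plus[symmetric]
        del: ennreal_plus ennreal_mult'')
    then have "ennreal \<bar>b x * m - w\<bar> \<le> ennreal k"
      by (intro ennreal_leI) auto
    moreover have "commutator b f x = ereal (b x * m - w)"
      using m w by (simp add: commutator_def)
    ultimately show ?thesis
      using real by simp
  qed simp
  then show "e2ennreal \<bar>commutator b f x\<bar> \<le> ennreal (K * real CARD('n) powr \<beta>) * N"
    by (simp add: E_def)
qed

lemma commutator_bounded_of_lipschitz:
  fixes b :: "real ^ 'n \<Rightarrow> real"
  assumes b [measurable]: "b \<in> borel_measurable lebesgue"
    and \<beta>: "0 < \<beta>" and p: "1 < p" "p < real CARD('n) / \<beta>"
    and q: "0 < q" "1 / q = 1 / p - \<beta> / real CARD('n)"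
    and lip: "b \<in> lipschitz_space \<beta>" and nonneg: "AE x in lebesgue. 0 \<le> b x"
  shows "commutator_bounded b p q"
proof -
  let ?n = "real CARD('n)"
  obtain g C where g: "\<And>x y. \<bar>g x - g y\<bar> \<le> C * norm (x - y) powr \<beta>" and bg: "AE x in lebesgue. b x = g x"
    using lip by (auto simp: lipschitz_space_def lipschitz_class_def)
  define K where "K = \<bar>C\<bar>"
  have gK: "\<bar>g x - g y\<bar> \<le> K * norm (x - y) powr \<beta>" for x y
    by (rule order_trans[OF g]) (simp add: K_def mult_right_mono)
  define \<theta> where "\<theta> = \<beta> * p / ?n"
  have \<theta>: "0 < \<theta>" "\<theta> < 1"
    using \<beta> p by (auto simp: \<theta>_def field_simps)
  \<comment> \<open>Because of this relation the \<open>q\<close>-th power of Hedberg's bound is the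
    \<open>p\<close>-th power of the maximal function, to which the strong type bound
    applies.\<close>
  have \<theta>q: "(1 - \<theta>) * q = p"
    using q p by (simp add: \<theta>_def field_simps)
  define S where "S = 2 powr p * 3 ^ CARD('n) * p / (p - 1)"
  have S: "0 < S"
    using p by (simp add: S_def)
  define D where "D = K * ?n powr \<beta> * 2 powr \<theta> * S powr (1 / q)"
  have D: "0 \<le> D"
    by (simp add: D_def K_def)
  \<comment> \<open>\<open>T\<close> is any positive upper bound for the norm of \<open>f\<close>;
    Hedberg's splitting needs it positive, whereas the norm may be 0.\<close>
  have bound: "(AE x in lebesgue. commutator_defined_at b f x) \<and> Lp_norm q (commutator b f) \<le> ennreal (D * T)"
    if f [measurable]: "f \<in> borel_measurable lebesgue" and T: "0 < T"
      and fT: "(\<integral>\<^sup>+ x. ennpow (ennreal \<bar>f x\<bar>) p \<partial>lebesgue) \<le> ennreal (T powr p)" for f :: "real ^ 'n \<Rightarrow> real" and T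
  proof -
    have strong: "(\<integral>\<^sup>+ x. ennpow (maximal f x) p \<partial>lebesgue) \<le> ennreal (S * T powr p)"
    proof -
      have "(\<integral>\<^sup>+ x. ennpow (maximal f x) p \<partial>lebesgue) \<le> ennreal S * (\<integral>\<^sup>+ x. ennpow (ennreal \<bar>f x\<bar>) p \<partial>lebesgue)"
        unfolding S_def using p by (intro maximal_strong_type f)
      also have "\<dots> \<le> ennreal S * ennreal (T powr p)"
        using fT by (rule mult_left_mono) simp
      finally show ?thesis
        using S by (simp add: ennreal_mult)
    qed
    \<comment> \<open>The finite integral makes the maximal function finite almost everywhere, which
      excludes the indeterminate case of the commutator.\<close>
    have "AE x in lebesgue. ennpow (maximal f x) p \<noteq> \<infinity>"
      using strong by (intro nn_integral_noteq_infinite) (auto simp: top_unique)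
    then have fin: "AE x in lebesgue. maximal f x < \<infinity>"
      by eventually_elim (metis ennpow_top infinity_ennreal_def less_top)
    define N where "N x = ennreal ((2 * T) powr \<theta>) * ennpow (maximal f x) (1 - \<theta>)" for x
    have pointwise: "AE x in lebesgue. commutator_defined_at b f x \<and>
        e2ennreal \<bar>commutator b f x\<bar> \<le> ennreal (K * ?n powr \<beta>) * N x"
      using fin bg nonneg
    proof eventually_elim
      case (elim x)
      have "AE y in lebesgue. \<bar>b x - \<bar>b y\<bar>\<bar> \<le> K * norm (x - y) powr \<beta>"
        using bg nonneg by eventually_elim (use gK[of x] elim in auto)
      moreover have "ennreal (l powr \<beta>) * (\<integral>\<^sup>+ y \<in> cbox a (a + vec l). ennreal \<bar>f y\<bar> \<partial>lebesgue)
          \<le> N x * ennreal (l ^ CARD('n))" if "0 < l" "x \<in> cbox a (a + vec l)" for a l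
        unfolding N_def \<theta>_def using that \<beta> p T fT by (intro fractional_average_le) auto
      ultimately show ?case
        using elim \<beta> commutator_pointwise_le[of b f \<beta> K x "N x"] by (auto simp: K_def)
    qed
    have "(\<integral>\<^sup>+ x. ennpow (e2ennreal \<bar>commutator b f x\<bar>) q \<partial>lebesgue)
        \<le> (\<integral>\<^sup>+ x. ennreal ((K * ?n powr \<beta> * (2 * T) powr \<theta>) powr q) * ennpow (maximal f x) p \<partial>lebesgue)"
    proof (rule nn_integral_mono_AE)
      show "AE x in lebesgue. ennpow (e2ennreal \<bar>commutator b f x\<bar>) q
          \<le> ennreal ((K * ?n powr \<beta> * (2 * T) powr \<theta>) powr q) * ennpow (maximal f x) p"
        using pointwise
      proof eventually_elim
        case (elim x)
        then have "ennpow (e2ennreal \<bar>commutator b f x\<bar>) q \<le> ennpow (ennreal (K * ?n powr \<beta>) * N x) q"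
          using q by (intro ennpow_mono) auto
        also have "ennreal (K * ?n powr \<beta>) * N x
            = ennreal (K * ?n powr \<beta> * (2 * T) powr \<theta>) * ennpow (maximal f x) (1 - \<theta>)"
          by (simp add: N_def K_def ennreal_mult mult.assoc)
        also have "ennpow \<dots> q = ennreal ((K * ?n powr \<beta> * (2 * T) powr \<theta>) powr q) * ennpow (maximal f x) p"
          using q(1) \<theta>q by (simp add: ennpow_mult ennpow_ennpow ennpow_ennreal K_def)
        finally show ?case .
      qed
    qed
    also have "\<dots> = ennreal ((K * ?n powr \<beta> * (2 * T) powr \<theta>) powr q) * (\<integral>\<^sup>+ x. ennpow (maximal f x) p \<partial>lebesgue)"
      by (intro nn_integral_cmult) measurable
    also have "\<dots> \<le> ennreal ((K * ?n powr \<beta> * (2 * T) powr \<theta>) powr q) * ennreal (S * T powr p)"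
      using strong by (rule mult_left_mono) simp
    also have "\<dots> = ennreal ((K * ?n powr \<beta> * (2 * T) powr \<theta>) powr q * (S * T powr p))"
      using S by (intro ennreal_mult[symmetric]) auto
    also have "(K * ?n powr \<beta> * (2 * T) powr \<theta>) powr q * (S * T powr p) = (D * T) powr q"
    proof -
      \<comment> \<open>Hedberg's bound contributes the exponent \<theta> q and the strong type
        bound the exponent \<open>p\<close>; their sum is \<open>q\<close>.\<close>
      have "T powr (\<theta> * q) * T powr p = T powr q"
        using \<theta>q by (simp add: powr_add[symmetric] algebra_simps)
      then show ?thesis
        using S T q(1) by (simp add: D_def K_def powr_mult powr_powr mult_ac)
    qed
    finally have "Lp_norm q (commutator b f) \<le> ennreal (D * T)"
      using q(1) D T by (simp add: Lp_norm_def ennpow_le_iff ennpow_ennreal)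
    then show ?thesis
      using pointwise by auto
  qed
  show ?thesis
    unfolding commutator_bounded_def
  proof (intro exI[of _ D] conjI allI impI D)
    fix f :: "real ^ 'n \<Rightarrow> real" assume f: "(\<lambda>x. ereal (f x)) \<in> Lp_space p"
    have f_meas [measurable]: "f \<in> borel_measurable lebesgue"
      using f by (auto simp: Lp_space_def)
    obtain F where F: "Lp_norm p (\<lambda>x. ereal (f x)) = ennreal F" "0 \<le> F"
      using f by (cases "Lp_norm p (\<lambda>x. ereal (f x))") (auto simp: Lp_space_def)
    have fT: "(\<integral>\<^sup>+ x. ennpow (ennreal \<bar>f x\<bar>) p \<partial>lebesgue) \<le> ennreal (T powr p)" if "F \<le> T" for T
    proof -
      have "Lp_norm p (\<lambda>x. ereal (f x)) \<le> ennreal T"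
        using F that by (simp add: ennreal_leI)
      then show ?thesis
        using p F that by (simp add: Lp_norm_def ennpow_le_iff ennpow_ennreal)
    qed
    show "AE x in lebesgue. commutator_defined_at b f x"
      using bound[OF f_meas _ fT, of "F + 1"] F by simp
    have "Lp_norm q (commutator b f) \<le> ennreal (D * (F + 1))"
      using bound[OF f_meas _ fT, of "F + 1"] F by simp
    then have "Lp_norm q (commutator b f) < \<infinity>"
      by (rule le_less_trans) simp
    moreover have "commutator b f \<in> borel_measurable lebesgue"
      unfolding commutator_def by measurable
    ultimately show "commutator b f \<in> Lp_space q"
      by (simp add: Lp_space_def)
    \<comment> \<open>Letting \<open>T = F + e\<close> decrease to the norm \<open>F\<close> also
      covers \<open>F = 0\<close>.\<close>
    have "((\<lambda>e. ennreal (D * (F + e))) \<longlongrightarrow> ennreal (D * (F + 0))) (at_right 0)"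
      by (intro tendsto_intros)
    moreover have "\<forall>\<^sub>F e in at_right (0::real). Lp_norm q (commutator b f) \<le> ennreal (D * (F + e))"
      using eventually_at_right_less[of "0::real"]
      by eventually_elim (use bound[OF f_meas _ fT] F in auto)
    ultimately have "Lp_norm q (commutator b f) \<le> ennreal (D * (F + 0))"
      by (rule tendsto_lowerbound) simp
    then show "Lp_norm q (commutator b f) \<le> ennreal D * Lp_norm p (\<lambda>x. ereal (f x))"
      using D F by (simp add: ennreal_mult)
  qed
qed

subsection \<open>Indicator functions of cubes\<close>

text \<open>Averages of an indicator function never exceed 1, and the cube itself attains 1.\<close>

lemma maximal_indicator_cube:
  fixes x :: "real ^ 'n"
  assumes l: "0 < l" and x: "x \<in> cbox a (a + vec l)"
  shows "maximal (indicator (cbox a (a + vec l))) x = 1"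
proof (rule antisym)
  show "maximal (indicator (cbox a (a + vec l))) x \<le> 1"
    unfolding maximal_le_iff
  proof (intro allI impI)
    fix c :: "real ^ 'n" and k :: real assume k: "0 < k"
    have "(\<integral>\<^sup>+ y \<in> cbox c (c + vec k). ennreal \<bar>indicator (cbox a (a + vec l)) y\<bar> \<partial>lebesgue)
        \<le> (\<integral>\<^sup>+ y. indicator (cbox c (c + vec k)) y \<partial>lebesgue)"
      by (intro nn_integral_mono) (auto simp: indicator_def)
    then show "(\<integral>\<^sup>+ y \<in> cbox c (c + vec k). ennreal \<bar>indicator (cbox a (a + vec l)) y\<bar> \<partial>lebesgue)
        \<le> 1 * ennreal (k ^ CARD('n))"
      using k by (simp add: emeasure_cube)
  qed
  have "(\<integral>\<^sup>+ y \<in> cbox a (a + vec l). ennreal \<bar>indicator (cbox a (a + vec l)) y\<bar> \<partial>lebesgue)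
      = (\<integral>\<^sup>+ y. indicator (cbox a (a + vec l)) y \<partial>lebesgue)"
    by (intro nn_integral_cong) (auto simp: indicator_def)
  then have "ennreal (l ^ CARD('n)) \<le> maximal (indicator (cbox a (a + vec l))) x * ennreal (l ^ CARD('n))"
    using nn_integral_cube_le_maximal[OF l x, of "indicator (cbox a (a + vec l))"] l
    by (simp add: emeasure_cube)
  then show "1 \<le> maximal (indicator (cbox a (a + vec l))) x"
    using l by (cases "maximal (indicator (cbox a (a + vec l))) x")
      (auto simp: ennreal_mult[symmetric] simp del: ennreal_mult'')
qed

text \<open>A cube through \<open>x\<close> that sticks out of \<open>Q\<^sub>0\<close> can be slid into \<open>Q\<^sub>0\<close>, or replaced by
  \<open>Q\<^sub>0\<close> if it is larger, without losing any of its intersection with \<open>Q\<^sub>0\<close>.\<close>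

lemma maximal_mult_indicator_cube:
  fixes x :: "real ^ 'n"
  assumes l: "0 < l" and x: "x \<in> cbox a (a + vec l)"
  shows "maximal (\<lambda>y. b y * indicator (cbox a (a + vec l)) y) x = maximal_on (cbox a (a + vec l)) b x"
    (is "maximal ?f x = maximal_on ?Q b x")
proof (rule antisym)
  show "maximal ?f x \<le> maximal_on ?Q b x"
    unfolding maximal_le_iff
  proof (intro allI impI)
    fix c :: "real ^ 'n" and k :: real assume k: "0 < k" and xc: "x \<in> cbox c (c + vec k)"
    have "\<exists>c' k'. 0 < k' \<and> k' \<le> k \<and> x \<in> cbox c' (c' + vec k') \<and> cbox c' (c' + vec k') \<subseteq> ?Q
        \<and> cbox c (c + vec k) \<inter> ?Q \<subseteq> cbox c' (c' + vec k')"
    proof (cases "l \<le> k")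
      case True
      then show ?thesis
        using l x by blast
    next
      case False
      \<comment> \<open>Clamps each coordinate of the corner to the range in which a cube of side
        \<open>k\<close> stays inside \<open>?Q\<close>.\<close>
      define c' where "c' = (\<chi> i. max (a $ i) (min (c $ i) (a $ i + l - k)))"
      have c': "a $ i \<le> c' $ i" "c' $ i \<le> a $ i + l - k" for i
        using False by (auto simp: c'_def)
      have "cbox c' (c' + vec k) \<subseteq> ?Q"
      proof
        fix y assume "y \<in> cbox c' (c' + vec k)"
        then have "c' $ i \<le> y $ i" "y $ i \<le> c' $ i + k" for i
          by (simp_all add: mem_box_cart)
        with c' show "y \<in> ?Q"
          unfolding mem_box_cart by (simp, smt (verit))
      qed
      moreover have sub: "y \<in> cbox c' (c' + vec k)" if "y \<in> cbox c (c + vec k)" "y \<in> ?Q" for y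
        unfolding mem_box_cart
      proof
        fix i
        have "c $ i \<le> y $ i" "y $ i \<le> c $ i + k" "a $ i \<le> y $ i" "y $ i \<le> a $ i + l"
          using that by (simp_all add: mem_box_cart)
        then show "c' $ i \<le> y $ i \<and> y $ i \<le> (c' + vec k) $ i"
          by (auto simp: c'_def)
      qed
      ultimately show ?thesis
        using k x xc by blast
    qed
    then obtain c' k' where k': "0 < k'" "k' \<le> k" "x \<in> cbox c' (c' + vec k')"
      "cbox c' (c' + vec k') \<subseteq> ?Q" "cbox c (c + vec k) \<inter> ?Q \<subseteq> cbox c' (c' + vec k')"
      by blast
    have "(\<integral>\<^sup>+ y \<in> cbox c (c + vec k). ennreal \<bar>?f y\<bar> \<partial>lebesgue)
        \<le> (\<integral>\<^sup>+ y \<in> cbox c' (c' + vec k'). ennreal \<bar>b y\<bar> \<partial>lebesgue)"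
      using k'(5) by (intro nn_integral_mono) (auto simp: indicator_def)
    also have "\<dots> \<le> maximal_on ?Q b x * ennreal (k' ^ CARD('n))"
      using k' by (intro nn_integral_cube_le_maximal_on)
    \<comment> \<open>The replacement cube is no larger than the original, so passing to the volume
      of the original only weakens the bound.\<close>
    also have "\<dots> \<le> maximal_on ?Q b x * ennreal (k ^ CARD('n))"
      using k' by (intro mult_left_mono ennreal_leI power_mono) auto
    finally show "(\<integral>\<^sup>+ y \<in> cbox c (c + vec k). ennreal \<bar>?f y\<bar> \<partial>lebesgue)
        \<le> maximal_on ?Q b x * ennreal (k ^ CARD('n))" .
  qed
  show "maximal_on ?Q b x \<le> maximal ?f x"
    unfolding maximal_on_le_iff
  proof (intro allI impI)
    fix c :: "real ^ 'n" and k :: real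
    assume k: "0 < k" "cbox c (c + vec k) \<subseteq> ?Q" "x \<in> cbox c (c + vec k)"
    have "(\<integral>\<^sup>+ y \<in> cbox c (c + vec k). ennreal \<bar>b y\<bar> \<partial>lebesgue)
        = (\<integral>\<^sup>+ y \<in> cbox c (c + vec k). ennreal \<bar>?f y\<bar> \<partial>lebesgue)"
      using k by (intro nn_integral_cong) (auto simp: indicator_def)
    also have "\<dots> \<le> maximal ?f x * ennreal (k ^ CARD('n))"
      using k by (intro nn_integral_cube_le_maximal)
    finally show "(\<integral>\<^sup>+ y \<in> cbox c (c + vec k). ennreal \<bar>b y\<bar> \<partial>lebesgue)
        \<le> maximal ?f x * ennreal (k ^ CARD('n))" .
  qed
qed

lemma Lp_norm_indicator_cube:
  fixes a :: "real ^ 'n"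
  assumes l: "0 < l" and p: "0 < p"
  shows "Lp_norm p (\<lambda>x. ereal (indicator (cbox a (a + vec l)) x)) = ennreal (l powr (real CARD('n) / p))"
proof -
  have "(\<integral>\<^sup>+ x. ennpow (e2ennreal \<bar>ereal (indicator (cbox a (a + vec l)) x)\<bar>) p \<partial>lebesgue)
      = (\<integral>\<^sup>+ x. indicator (cbox a (a + vec l)) x \<partial>lebesgue)"
    using ennpow_ennreal[of 1 p] by (intro nn_integral_cong) (auto simp: indicator_def)
  then show ?thesis
    using l p by (simp add: Lp_norm_def emeasure_cube ennpow_ennreal powr_powr flip: powr_realpow)
qed

lemma oscillation_le_of_commutator_bounded:
  fixes b :: "real ^ 'n \<Rightarrow> real"
  assumes \<beta>: "0 < \<beta>" and p: "1 < p" and q: "0 < q" "1 / q = 1 / p - \<beta> / real CARD('n)"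
    and "commutator_bounded b p q"
  shows "\<exists>C>0. (SUP Q \<in> (cubes :: (real ^ 'n) set set). oscillation b \<beta> q Q) \<le> ennreal C"
proof -
  obtain C where C: "0 \<le> C" and bound: "\<And>f :: real ^ 'n \<Rightarrow> real. (\<lambda>x. ereal (f x)) \<in> Lp_space p \<Longrightarrow>
      Lp_norm q (commutator b f) \<le> ennreal C * Lp_norm p (\<lambda>x. ereal (f x))"
    using assms(5) by (auto simp: commutator_bounded_def)
  have "oscillation b \<beta> q (cbox a (a + vec l)) \<le> ennreal C" if l: "0 < l" for a :: "real ^ 'n" and l
  proof -
    let ?Q = "cbox a (a + vec l)"
    have norm: "Lp_norm p (\<lambda>x. ereal (indicator ?Q x)) = ennreal (l powr (real CARD('n) / p))"
      using l p by (intro Lp_norm_indicator_cube) auto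
    have "(\<lambda>x. indicator ?Q x :: real) \<in> borel_measurable lebesgue"
      by measurable
    then have "(\<lambda>x. ereal (indicator ?Q x)) \<in> Lp_space p"
      using norm by (simp add: Lp_space_def)
    then have "Lp_norm q (commutator b (indicator ?Q)) \<le> ennreal C * ennreal (l powr (real CARD('n) / p))"
      using bound[of "indicator ?Q"] norm by simp
    also have "\<dots> = ennreal (C * l powr (real CARD('n) / p))"
      using C by (intro ennreal_mult[symmetric]) auto
    finally have le: "(\<integral>\<^sup>+ x. ennpow (e2ennreal \<bar>commutator b (indicator ?Q) x\<bar>) q \<partial>lebesgue)
        \<le> ennreal ((C * l powr (real CARD('n) / p)) powr q)"
      using C q(1) by (simp add: Lp_norm_def ennpow_le_iff ennpow_ennreal)
    \<comment> \<open>The commutator is explicit on \<open>?Q\<close> only; the part of its norm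
      outside \<open>?Q\<close> is discarded below.\<close>
    have "commutator b (indicator ?Q) x = ereal (b x) - enn2ereal (maximal_on ?Q b x)" if "x \<in> ?Q" for x
      using maximal_indicator_cube[OF l that] maximal_mult_indicator_cube[OF l that, of b]
      by (simp add: commutator_def one_ennreal.rep_eq)
    then have "(\<integral>\<^sup>+ x \<in> ?Q. ennpow (e2ennreal \<bar>ereal (b x) - enn2ereal (maximal_on ?Q b x)\<bar>) q \<partial>lebesgue)
        \<le> (\<integral>\<^sup>+ x. ennpow (e2ennreal \<bar>commutator b (indicator ?Q) x\<bar>) q \<partial>lebesgue)"
      by (intro nn_integral_mono) (auto simp: indicator_def)
    also note le
    also have "(C * l powr (real CARD('n) / p)) powr q = (C * l powr \<beta>) powr q * l ^ CARD('n)"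
    proof -
      \<comment> \<open>The relation between the exponents turns the norm of the indicator into
        \<open>l powr \<beta>\<close> times the \<open>q\<close>-th root of the volume.\<close>
      have "real CARD('n) / p = \<beta> + real CARD('n) / q"
        using q(2) by (simp add: field_simps)
      then have "real CARD('n) / p * q = \<beta> * q + real CARD('n)"
        using q(1) by (simp add: distrib_right)
      then show ?thesis
        using C l by (simp add: powr_mult powr_powr powr_add powr_realpow)
    qed
    finally show ?thesis
      using l q C by (simp add: oscillation_le_iff)
  qed
  then have "(SUP Q \<in> (cubes :: (real ^ 'n) set set). oscillation b \<beta> q Q) \<le> ennreal C"
    by (intro SUP_least) (auto simp: cubes_def)
  \<comment> \<open>\<open>C\<close> may be 0, but the claim asks for a positive constant.\<close>
  also have "\<dots> \<le> ennreal (C + 1)"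
    by (intro ennreal_leI) simp
  finally show ?thesis
    using C by (intro exI[of _ "C + 1"]) auto
qed

subsection \<open>Campanato averages\<close>

text \<open>A grid of \<open>m ^ CARD('n)\<close> closed cubes of side \<open>l / m\<close> covers
  the cube; the overlaps of their faces do no harm to an upper bound.\<close>

lemma nn_integral_cube_subdivide:
  fixes h :: "real ^ 'n \<Rightarrow> ennreal" and m :: nat
  assumes [measurable]: "h \<in> borel_measurable lebesgue" and l: "0 < l" and m: "0 < m"
    and B: "\<And>c. (\<integral>\<^sup>+ x \<in> cbox c (c + vec (l / m)). h x \<partial>lebesgue) \<le> ennreal B" "0 \<le> B"
  shows "(\<integral>\<^sup>+ x \<in> cbox a (a + vec l). h x \<partial>lebesgue) \<le> ennreal (real m ^ CARD('n) * B)"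
proof -
  define I where "I = (UNIV :: 'n set) \<rightarrow>\<^sub>E {..<m}"
  define c where "c k = (\<chi> i. a $ i + real (k i) * (l / m))" for k :: "'n \<Rightarrow> nat"
  have fin: "finite I"
    by (simp add: I_def finite_PiE)
  have card: "card I = m ^ CARD('n)"
    by (simp add: I_def card_funcsetE)
  \<comment> \<open>One coordinate at a time, the index is the integer part of
    \<open>u / (l / m)\<close>, except that the endpoint \<open>u = l\<close> would give
    \<open>m\<close> and is put into the last interval.\<close>
  have grid: "\<exists>j<m. real j * (l / m) \<le> u \<and> u \<le> real j * (l / m) + l / m" if u: "0 \<le> u" "u \<le> l" for u
  proof (cases "u = l")
    case True
    then show ?thesis
      using m l by (intro exI[of _ "m - 1"]) (auto simp: of_nat_diff field_simps)
  next
    case False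
    define j where "j = nat \<lfloor>u / (l / m)\<rfloor>"
    have "0 \<le> u / (l / m)" "u / (l / m) < m"
      using u False l m by (simp_all add: field_simps)
    then have j: "real j \<le> u / (l / m)" "u / (l / m) < real j + 1" "real j < m"
      unfolding j_def by linarith+
    then have "real j * (l / m) \<le> u" "u < (real j + 1) * (l / m)"
      using l m by (simp_all add: pos_le_divide_eq pos_divide_less_eq del: divide_divide_eq_right)
    then have "real j * (l / m) \<le> u" "u \<le> real j * (l / m) + l / m"
      by (auto simp only: distrib_right mult_1_left less_imp_le)
    with j(3) show ?thesis
      by auto
  qed
  have cover: "cbox a (a + vec l) \<subseteq> (\<Union>k\<in>I. cbox (c k) (c k + vec (l / m)))"
  proof
    fix x assume "x \<in> cbox a (a + vec l)"
    then have "0 \<le> x $ i - a $ i \<and> x $ i - a $ i \<le> l" for i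
      by (simp add: mem_box_cart algebra_simps)
    then have "\<forall>i. \<exists>j<m. real j * (l / m) \<le> x $ i - a $ i \<and> x $ i - a $ i \<le> real j * (l / m) + l / m"
      using grid by blast
    then obtain k where k: "\<And>i. k i < m" "\<And>i. real (k i) * (l / m) \<le> x $ i - a $ i"
        "\<And>i. x $ i - a $ i \<le> real (k i) * (l / m) + l / m"
      by metis
    have "c k $ i \<le> x $ i \<and> x $ i \<le> (c k + vec (l / m)) $ i" for i
      using k(2,3)[of i] by (simp add: c_def)
    then have "x \<in> cbox (c k) (c k + vec (l / m))"
      unfolding mem_box_cart by blast
    moreover have "k \<in> I"
      using k(1) by (simp add: I_def PiE_UNIV_domain)
    ultimately show "x \<in> (\<Union>k\<in>I. cbox (c k) (c k + vec (l / m)))"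
      by blast
  qed
  have "(\<integral>\<^sup>+ x \<in> cbox a (a + vec l). h x \<partial>lebesgue)
      \<le> (\<integral>\<^sup>+ x. (\<Sum>k\<in>I. h x * indicator (cbox (c k) (c k + vec (l / m))) x) \<partial>lebesgue)"
  proof (rule nn_integral_mono)
    fix x
    show "h x * indicator (cbox a (a + vec l)) x \<le> (\<Sum>k\<in>I. h x * indicator (cbox (c k) (c k + vec (l / m))) x)"
    proof (cases "x \<in> cbox a (a + vec l)")
      case True
      then obtain k where k: "k \<in> I" "x \<in> cbox (c k) (c k + vec (l / m))"
        using cover by blast
      then have "h x * indicator (cbox a (a + vec l)) x = h x * indicator (cbox (c k) (c k + vec (l / m))) x"
        using True by simp
      also have "\<dots> \<le> (\<Sum>k\<in>I. h x * indicator (cbox (c k) (c k + vec (l / m))) x)"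
        using k fin by (intro member_le_sum) auto
      finally show ?thesis .
    qed simp
  qed
  also have "\<dots> = (\<Sum>k\<in>I. \<integral>\<^sup>+ x \<in> cbox (c k) (c k + vec (l / m)). h x \<partial>lebesgue)"
    by (intro nn_integral_sum) measurable
  also have "\<dots> \<le> (\<Sum>k\<in>I. ennreal B)"
    using B by (intro sum_mono)
  also have "\<dots> = ennreal (real m ^ CARD('n) * B)"
    using card B(2) by (simp add: ennreal_mult ennreal_of_nat_eq_real_of_nat)
  finally show ?thesis .
qed

text \<open>Summing the hypothesis over a subdivision into cubes of side \<open>l / m\<close>
  preserves the volume factor but replaces \<open>l powr \<beta>\<close> by
  \<open>(l / m) powr \<beta>\<close>, which tends to 0. So every cube integral vanishes, and
  countably many cubes exhaust the space.\<close>

lemma AE_eq_zero_of_cube_decay: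
  fixes h :: "real ^ 'n \<Rightarrow> ennreal"
  assumes h [measurable]: "h \<in> borel_measurable lebesgue" and \<beta>: "0 < \<beta>" and D: "0 \<le> D"
    and decay: "\<And>a l. 0 < l \<Longrightarrow>
      (\<integral>\<^sup>+ x \<in> cbox a (a + vec l). h x \<partial>lebesgue) \<le> ennreal (D * l powr \<beta> * l ^ CARD('n))"
  shows "AE x in lebesgue. h x = 0"
proof -
  have zero: "(\<integral>\<^sup>+ x \<in> cbox a (a + vec l). h x \<partial>lebesgue) = 0" if l: "0 < l" for a l
  proof -
    have "((\<lambda>m. ennreal (D * (l / real m) powr \<beta> * l ^ CARD('n))) \<longlongrightarrow> ennreal (D * 0 * l ^ CARD('n))) sequentially"
    proof (intro tendsto_intros)
      have "(\<lambda>m. (l / real m)) \<longlonglongrightarrow> 0"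
        by (intro real_tendsto_divide_at_top[OF tendsto_const] filterlim_real_sequentially)
      then have "(\<lambda>m. (l / real m) powr \<beta>) \<longlonglongrightarrow> 0 powr \<beta>"
        using \<beta> l by (intro tendsto_powr2) auto
      then show "(\<lambda>m. (l / real m) powr \<beta>) \<longlonglongrightarrow> 0"
        by simp
    qed
    moreover have "\<forall>\<^sub>F m in sequentially. (\<integral>\<^sup>+ x \<in> cbox a (a + vec l). h x \<partial>lebesgue)
        \<le> ennreal (D * (l / real m) powr \<beta> * l ^ CARD('n))"
      using eventually_gt_at_top[of 0]
    proof eventually_elim
      case (elim m)
      have "(\<integral>\<^sup>+ x \<in> cbox a (a + vec l). h x \<partial>lebesgue)
          \<le> ennreal (real m ^ CARD('n) * (D * (l / real m) powr \<beta> * (l / real m) ^ CARD('n)))"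
        using l elim D by (intro nn_integral_cube_subdivide h decay) auto
      also have "real m ^ CARD('n) * (D * (l / real m) powr \<beta> * (l / real m) ^ CARD('n))
          = D * (l / real m) powr \<beta> * l ^ CARD('n)"
        using elim by (simp add: power_divide)
      finally show ?case .
    qed
    ultimately have "(\<integral>\<^sup>+ x \<in> cbox a (a + vec l). h x \<partial>lebesgue) \<le> ennreal (D * 0 * l ^ CARD('n))"
      by (rule tendsto_lowerbound) simp
    then show ?thesis
      by simp
  qed
  have "AE x in lebesgue. h x * indicator (cbox (- vec (real k)) (- vec (real k) + vec (2 * real k))) x = 0"
    if "0 < k" for k :: nat
  proof -
    have "(\<integral>\<^sup>+ x \<in> cbox (- vec (real k)) (- vec (real k) + vec (2 * real k)). h x \<partial>lebesgue) = 0"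
      using that by (intro zero) simp
    then show ?thesis
      by (rule nn_integral_0_iff_AE[THEN iffD1, rotated]) measurable
  qed
  then have "AE x in lebesgue. \<forall>k::nat. 0 < k \<longrightarrow>
      h x * indicator (cbox (- vec (real k)) (- vec (real k) + vec (2 * real k))) x = 0"
    by (simp add: AE_all_countable)
  then show ?thesis
  proof eventually_elim
    case (elim x)
    obtain k where k: "norm x < real k"
      using reals_Archimedean2 by blast
    have "- real k \<le> x $ i \<and> x $ i \<le> real k" for i
      using component_le_norm_cart[of x i] k by linarith
    then have "x \<in> cbox (- vec (real k)) (- vec (real k) + vec (2 * real k))"
      by (simp add: mem_box_cart)
    moreover have "0 < k"
      using k by (cases k) auto
    ultimately show ?case
      using elim[rule_format, of k] by simp
  qed
qed

lemma nn_integral_set_eq_integral: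
  fixes f :: "'a \<Rightarrow> real"
  assumes "set_integrable M Q f" "\<And>x. x \<in> Q \<Longrightarrow> 0 \<le> f x"
  shows "(\<integral>\<^sup>+ x \<in> Q. ennreal (f x) \<partial>M) = ennreal (LINT x:Q|M. f x)"
proof -
  have "(\<integral>\<^sup>+ x \<in> Q. ennreal (f x) \<partial>M) = (\<integral>\<^sup>+ x. ennreal (indicator Q x *\<^sub>R f x) \<partial>M)"
    by (intro nn_integral_cong) (auto simp: indicator_def)
  also have "\<dots> = ennreal (LINT x:Q|M. f x)"
    using assms unfolding set_integrable_def set_lebesgue_integral_def
    by (intro nn_integral_eq_integral) (auto simp: indicator_def)
  finally show ?thesis .
qed

text \<open>Let \<open>u\<close> be the positive part of \<open>A - b\<close>, which is what
  \<open>ennreal (A - b x)\<close> records. As \<open>A\<close> is the average of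
  \<open>\<bar>b\<bar>\<close>, the functions \<open>\<bar>b\<bar> - b\<close> and
  \<open>A - b\<close> have the same integral, which is nonnegative and at most that of
  \<open>u\<close>. The second bound comes from
  \<open>\<bar>b - A\<bar> = 2 * u - (A - b)\<close>.\<close>

lemma deviation_from_abs_average:
  fixes b :: "real ^ 'n \<Rightarrow> real"
  assumes b: "set_integrable lebesgue (cbox a (a + vec l)) b" and l: "0 < l" and D: "0 \<le> D"
    and A: "(LINT x:cbox a (a + vec l)|lebesgue. \<bar>b x\<bar>) = A * l ^ CARD('n)"
    and le: "(\<integral>\<^sup>+ x \<in> cbox a (a + vec l). ennreal (A - b x) \<partial>lebesgue) \<le> ennreal D"
  shows "(\<integral>\<^sup>+ x \<in> cbox a (a + vec l). ennreal (\<bar>b x\<bar> - b x) \<partial>lebesgue) \<le> ennreal D"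
    and "(\<integral>\<^sup>+ x \<in> cbox a (a + vec l). ennreal \<bar>b x - A\<bar> \<partial>lebesgue) \<le> ennreal (2 * D)"
proof -
  let ?Q = "cbox a (a + vec l)"
  let ?J = "\<lambda>f :: real ^ 'n \<Rightarrow> real. LINT x:?Q|lebesgue. f x"
  define u where "u x = max 0 (A - b x)" for x
  have const: "set_integrable lebesgue ?Q (\<lambda>x. A)"
    unfolding set_integrable_def using emeasure_lborel_cbox_finite[of a "a + vec l"]
    by (intro integrable_scaleR_left integrable_real_indicator) auto
  have diff: "set_integrable lebesgue ?Q (\<lambda>x. A - b x)"
    using const b by (rule set_integral_diff(1))
  have u_eq: "u x = (\<bar>A - b x\<bar> + (A - b x)) / 2" for x
    by (simp add: u_def max_def abs_if)
  have u: "set_integrable lebesgue ?Q u"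
    unfolding u_eq using diff by (intro set_integrable_divide set_integral_add(1) set_integrable_abs)
  have u2: "set_integrable lebesgue ?Q (\<lambda>x. 2 * u x)"
    using u by (intro set_integrable_mult_right)
  have J_const: "?J (\<lambda>x. A) = A * l ^ CARD('n)"
    using l by (simp add: set_lebesgue_integral_def measure_def emeasure_cube)
  have J_diff: "?J (\<lambda>x. A - b x) = A * l ^ CARD('n) - ?J b"
    using set_integral_diff(2)[OF const b] J_const by simp
  have "(\<integral>\<^sup>+ x \<in> ?Q. ennreal (A - b x) \<partial>lebesgue) = (\<integral>\<^sup>+ x \<in> ?Q. ennreal (u x) \<partial>lebesgue)"
    by (intro nn_integral_cong) (auto simp: u_def max_def ennreal_neg)
  also have "\<dots> = ennreal (?J u)"
    by (rule nn_integral_set_eq_integral[OF u]) (simp add: u_def)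
  finally have Ju: "?J u \<le> D"
    using le D by simp
  have J_diff_le: "A * l ^ CARD('n) - ?J b \<le> D"
  proof -
    have "?J (\<lambda>x. A - b x) \<le> ?J u"
      using diff u by (rule set_integral_mono) (simp add: u_def)
    then show ?thesis
      using Ju J_diff by simp
  qed
  have J_le: "?J b \<le> A * l ^ CARD('n)"
    using set_integral_mono[OF b set_integrable_abs[OF b]] A by simp
  have "(\<integral>\<^sup>+ x \<in> ?Q. ennreal (\<bar>b x\<bar> - b x) \<partial>lebesgue) = ennreal (?J (\<lambda>x. \<bar>b x\<bar> - b x))"
    using b by (intro nn_integral_set_eq_integral set_integral_diff(1) set_integrable_abs) auto
  also have "?J (\<lambda>x. \<bar>b x\<bar> - b x) = A * l ^ CARD('n) - ?J b"
    using set_integral_diff(2)[OF set_integrable_abs[OF b] b] A by simp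
  finally show "(\<integral>\<^sup>+ x \<in> ?Q. ennreal (\<bar>b x\<bar> - b x) \<partial>lebesgue) \<le> ennreal D"
    using J_diff_le by (simp add: ennreal_leI)
  have "(\<integral>\<^sup>+ x \<in> ?Q. ennreal \<bar>b x - A\<bar> \<partial>lebesgue) = (\<integral>\<^sup>+ x \<in> ?Q. ennreal (2 * u x - (A - b x)) \<partial>lebesgue)"
    by (intro nn_integral_cong) (auto simp: u_def max_def abs_if)
  also have "\<dots> = ennreal (?J (\<lambda>x. 2 * u x - (A - b x)))"
    by (rule nn_integral_set_eq_integral[OF set_integral_diff(1)[OF u2 diff]]) (simp add: u_def max_def)
  also have "?J (\<lambda>x. 2 * u x - (A - b x)) = 2 * ?J u - (A * l ^ CARD('n) - ?J b)"
    using set_integral_diff(2)[OF u2 diff] J_diff by simp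
  finally show "(\<integral>\<^sup>+ x \<in> ?Q. ennreal \<bar>b x - A\<bar> \<partial>lebesgue) \<le> ennreal (2 * D)"
    using Ju J_le by (simp add: ennreal_leI)
qed

text \<open>Campanato's argument: cube averages over shrinking cubes with a common corner
  converge at a rate controlled by the side length.\<close>

lemma campanato_averages:
  fixes A :: "real ^ 'n \<Rightarrow> real \<Rightarrow> real"
  assumes \<beta>: "0 < \<beta>" and E: "0 \<le> E"
    and near: "\<And>a l a' l'. 0 < l \<Longrightarrow> l \<le> l' \<Longrightarrow> l' \<le> 2 * l \<Longrightarrow>
      cbox a (a + vec l) \<subseteq> cbox a' (a' + vec l') \<Longrightarrow> \<bar>A a l - A a' l'\<bar> \<le> E * l' powr \<beta>"
  obtains g L where "0 \<le> L" "\<And>x y. \<bar>g x - g y\<bar> \<le> L * norm (x - y) powr \<beta>"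
    "\<And>x l. 0 < l \<Longrightarrow> \<bar>g x - A x l\<bar> \<le> L * l powr \<beta>"
proof -
  have half: "2 powr (- \<beta>) < (1::real)"
    using \<beta> by (simp add: powr_less_one)
  \<comment> \<open>The sum of the geometric series of the errors
    \<open>E * (l / 2 ^ k) powr \<beta>\<close>, with \<open>l powr \<beta>\<close> factored out;
    only its fixed point equation is needed.\<close>
  define G where "G = E / (1 - 2 powr (- \<beta>))"
  have G: "0 \<le> G" "G * 2 powr (- \<beta>) + E = G" "E \<le> G"
  proof -
    show G0: "0 \<le> G"
      using E half by (simp add: G_def)
    show eq: "G * 2 powr (- \<beta>) + E = G"
    proof -
      have "1 - 2 powr (- \<beta>) \<noteq> 0"
        using half by linarith
      then have "G * (1 - 2 powr (- \<beta>)) = E"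
        by (simp add: G_def)
      then show ?thesis
        by (simp add: algebra_simps)
    qed
    show "E \<le> G"
      using eq G0 by (metis add_increasing mult_nonneg_nonneg order_refl powr_ge_zero)
  qed
  \<comment> \<open>Induction on the number of halvings that bring \<open>l\<close> below
    \<open>s\<close>; for \<open>k = 0\<close> the assumptions are contradictory. One comparison
    costs \<open>E * l powr \<beta>\<close>, and the remaining ones start at
    \<open>l / 2\<close>.\<close>
  have cauchy: "\<bar>A x s - A x l\<bar> \<le> G * l powr \<beta>" if "l / 2 ^ k < s" "s \<le> l" "0 < l" for x s l k
    using that
  proof (induction k arbitrary: l)
    case 0
    then show ?case
      by simp
  next
    case (Suc k)
    have s: "0 < s"
      using Suc.prems by (meson divide_pos_pos less_trans zero_less_numeral zero_less_power)
    show ?case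
    proof (cases "l \<le> 2 * s")
      case True
      have "cbox x (x + vec s) \<subseteq> cbox x (x + vec l)"
        using Suc.prems by (auto simp: mem_box_cart) (smt (verit))
      then have "\<bar>A x s - A x l\<bar> \<le> E * l powr \<beta>"
        using s True Suc.prems by (intro near) auto
      also have "\<dots> \<le> G * l powr \<beta>"
        using G by (intro mult_right_mono) auto
      finally show ?thesis .
    next
      case False
      have "\<bar>A x s - A x (l / 2)\<bar> \<le> G * (l / 2) powr \<beta>"
        using Suc.prems False by (intro Suc.IH) (auto simp: field_simps)
      moreover have "(l / 2) powr \<beta> = 2 powr (- \<beta>) * l powr \<beta>"
        using Suc.prems by (simp add: powr_divide powr_minus field_simps)
      moreover have "\<bar>A x (l / 2) - A x l\<bar> \<le> E * l powr \<beta>"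
      proof (intro near)
        show "cbox x (x + vec (l / 2)) \<subseteq> cbox x (x + vec l)"
          using Suc.prems by (auto simp: mem_box_cart) (smt (verit) field_sum_of_halves)
      qed (use Suc.prems in auto)
      ultimately have "\<bar>A x s - A x l\<bar> \<le> (G * 2 powr (- \<beta>) + E) * l powr \<beta>"
        by (simp add: distrib_right mult.assoc)
      then show ?thesis
        using G(2) by simp
    qed
  qed
  have cauchy': "\<bar>A x s - A x l\<bar> \<le> G * l powr \<beta>" if "0 < s" "s \<le> l" for x s l
  proof -
    have "0 < s / l"
      using that by (intro divide_pos_pos) auto
    then obtain k where "(1 / 2) ^ k < s / l"
      using real_arch_pow_inv[of "s / l" "1 / 2"] by auto
    then have "l / 2 ^ k < s"
      using that by (simp add: field_simps power_divide)
    then show ?thesis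
      using that by (intro cauchy[of l k]) auto
  qed
  \<comment> \<open>The limit of the averages as a supremum of lower bounds: by \<open>cross\<close>
    each lower bound is below each upper bound, so \<open>g x\<close> lies within
    \<open>G * l powr \<beta>\<close> of \<open>A x l\<close> for every \<open>l\<close>.\<close>
  define g where "g x = (SUP l\<in>{0<..}. A x l - G * l powr \<beta>)" for x
  have cross: "A x l - G * l powr \<beta> \<le> A x k + G * k powr \<beta>" if lk: "0 < l" "0 < k" for x l k
  proof (cases "l \<le> k")
    case True
    then have "\<bar>A x l - A x k\<bar> \<le> G * k powr \<beta>"
      using lk by (intro cauchy') auto
    moreover have "0 \<le> G * l powr \<beta>"
      using G by simp
    ultimately show ?thesis
      by linarith
  next
    case False
    then have "\<bar>A x k - A x l\<bar> \<le> G * l powr \<beta>"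
      using lk by (intro cauchy') auto
    moreover have "0 \<le> G * k powr \<beta>"
      using G by simp
    ultimately show ?thesis
      by linarith
  qed
  have approx: "\<bar>g x - A x l\<bar> \<le> G * l powr \<beta>" if l: "0 < l" for x l
  proof -
    have "A x l - G * l powr \<beta> \<le> g x"
      unfolding g_def
    proof (rule cSUP_upper)
      show "bdd_above ((\<lambda>l. A x l - G * l powr \<beta>) ` {0<..})"
        using cross[of _ 1 x] by (intro bdd_aboveI2[of _ _ "A x 1 + G * 1 powr \<beta>"]) auto
    qed (use l in auto)
    moreover have "g x \<le> A x l + G * l powr \<beta>"
      unfolding g_def using cross l by (intro cSUP_least) auto
    ultimately show ?thesis
      by linarith
  qed
  \<comment> \<open>Two passages from \<open>g\<close> to \<open>A\<close> at side \<open>l\<close>,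
    and two comparisons with a common cube of side \<open>2 * l\<close>.\<close>
  define L where "L = 2 * G + 2 * (E * 2 powr \<beta>)"
  have holder: "\<bar>g x - g y\<bar> \<le> L * norm (x - y) powr \<beta>" for x y
  proof (cases "x = y")
    case False
    define l where "l = norm (x - y)"
    have l: "0 < l"
      using False by (simp add: l_def)
    \<comment> \<open>The lower corner of a cube of side \<open>2 * l\<close> that contains the
      cubes of side \<open>l\<close> at both \<open>x\<close> and \<open>y\<close>.\<close>
    define z where "z = (\<chi> i. min (x $ i) (y $ i))"
    have comp: "\<bar>x $ i - y $ i\<bar> \<le> l" for i
      using component_le_norm_cart[of "x - y" i] by (simp add: l_def)
    have "cbox x (x + vec l) \<subseteq> cbox z (z + vec (2 * l))" "cbox y (y + vec l) \<subseteq> cbox z (z + vec (2 * l))"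
      using comp by (auto simp: mem_box_cart z_def) (smt (verit))+
    then have "\<bar>A x l - A z (2 * l)\<bar> \<le> E * (2 * l) powr \<beta>" "\<bar>A y l - A z (2 * l)\<bar> \<le> E * (2 * l) powr \<beta>"
      using l by (auto intro!: near)
    moreover have "E * (2 * l) powr \<beta> = E * 2 powr \<beta> * l powr \<beta>"
      using l by (simp add: powr_mult)
    ultimately have "\<bar>g x - g y\<bar> \<le> 2 * (G * l powr \<beta>) + 2 * (E * 2 powr \<beta> * l powr \<beta>)"
      using approx[OF l, of x] approx[OF l, of y] by linarith
    also have "\<dots> = L * l powr \<beta>"
      by (simp add: L_def algebra_simps)
    finally show ?thesis
      by (simp add: l_def)
  qed simp
  have "G \<le> L" "0 \<le> L"
    using G E by (simp_all add: L_def add_increasing2)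
  moreover have "\<bar>g x - A x l\<bar> \<le> L * l powr \<beta>" if "0 < l" for x l
    using approx[OF that, of x] mult_right_mono[OF \<open>G \<le> L\<close>, of "l powr \<beta>"] by simp
  ultimately show thesis
    using holder that by blast
qed

text \<open>Serves to make the limit of the averages measurable.\<close>

lemma lipschitz_class_continuous:
  fixes g :: "real ^ 'n \<Rightarrow> real"
  assumes "\<And>x y. \<bar>g x - g y\<bar> \<le> L * norm (x - y) powr \<beta>" and \<beta>: "0 < \<beta>"
  shows "continuous_on UNIV g"
  unfolding continuous_on_def
proof
  fix x :: "real ^ 'n"
  have lim: "((\<lambda>y. L * norm (y - x) powr \<beta>) \<longlongrightarrow> L * norm (x - x) powr \<beta>) (at x within UNIV)"
    using \<beta> by (intro tendsto_mult tendsto_const tendsto_powr2 tendsto_norm tendsto_diff tendsto_ident_at) auto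
  have "((\<lambda>y. g y - g x) \<longlongrightarrow> 0) (at x within UNIV)"
  proof (rule Lim_null_comparison[rotated])
    show "((\<lambda>y. L * norm (y - x) powr \<beta>) \<longlongrightarrow> 0) (at x within UNIV)"
      using lim by simp
    show "\<forall>\<^sub>F y in at x within UNIV. norm (g y - g x) \<le> L * norm (y - x) powr \<beta>"
      unfolding real_norm_def by (intro always_eventually allI assms(1))
  qed
  then show "(g \<longlongrightarrow> g x) (at x within UNIV)"
    by (rule Lim_null[THEN iffD2])
qed

section \<open>From the oscillation bound to a nonnegative Lipschitz function\<close>

lemma lipschitz_of_oscillation:
  fixes b :: "real ^ 'n \<Rightarrow> real"
  assumes loc: "locally_integrable b" and \<beta>: "0 < \<beta>" and q: "1 < q" and C: "0 < C"
    and osc: "(SUP Q \<in> (cubes :: (real ^ 'n) set set). oscillation b \<beta> q Q) \<le> ennreal C"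
  shows "b \<in> lipschitz_space \<beta> \<and> (AE x in lebesgue. 0 \<le> b x)"
proof -
  note [measurable] = locally_integrable_measurable[OF loc]
  have b: "set_integrable lebesgue (cbox a c) b" for a c
    using loc by (simp add: locally_integrable_def)
  define A where "A a l = (LINT x:cbox a (a + vec l)|lebesgue. \<bar>b x\<bar>) / l ^ CARD('n)" for a l
  have A_eq: "(LINT x:cbox a (a + vec l)|lebesgue. \<bar>b x\<bar>) = A a l * l ^ CARD('n)" if "0 < l" for a l
    using that by (simp add: A_def)
  \<comment> \<open>The substitute for Jensen's inequality with
    \<open>T = C * l powr \<beta>\<close> passes from the \<open>q\<close>-th power to the first;
    \<open>ennreal\<close> cuts \<open>A a l - b x\<close> down to its positive part.\<close>
  have key: "(\<integral>\<^sup>+ x \<in> cbox a (a + vec l). ennreal (A a l - b x) \<partial>lebesgue)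
      \<le> ennreal (2 * (C * l powr \<beta>) * l ^ CARD('n))" if l: "0 < l" for a l
  proof (rule nn_integral_cube_le_of_ennpow[OF _ l q])
    let ?Q = "cbox a (a + vec l)"
    \<comment> \<open>\<open>?Q\<close> itself competes in the supremum, so
      \<open>maximal_on ?Q b x\<close> is at least \<open>A a l\<close>; if it is infinite, so is
      the right side.\<close>
    have dom: "ennreal (A a l - b x) \<le> e2ennreal \<bar>ereal (b x) - enn2ereal (maximal_on ?Q b x)\<bar>"
      if x: "x \<in> ?Q" for x
    proof (cases "maximal_on ?Q b x")
      case (real m)
      have "ennreal (A a l * l ^ CARD('n)) = (\<integral>\<^sup>+ y \<in> ?Q. ennreal \<bar>b y\<bar> \<partial>lebesgue)"
        using A_eq[OF l, of a] nn_integral_set_eq_integral[OF set_integrable_abs[OF b]] by simp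
      also have "\<dots> \<le> maximal_on ?Q b x * ennreal (l ^ CARD('n))"
        using l x by (intro nn_integral_cube_le_maximal_on) auto
      also have "\<dots> = ennreal (m * l ^ CARD('n))"
        using real l by (simp add: ennreal_mult)
      finally have "A a l \<le> m"
        using real l by simp
      then have "ennreal (A a l - b x) \<le> ennreal \<bar>b x - m\<bar>"
        by (intro ennreal_leI) auto
      then show ?thesis
        using real by simp
    qed simp
    have "(\<integral>\<^sup>+ x \<in> ?Q. ennpow (ennreal (A a l - b x)) q \<partial>lebesgue)
        \<le> (\<integral>\<^sup>+ x \<in> ?Q. ennpow (e2ennreal \<bar>ereal (b x) - enn2ereal (maximal_on ?Q b x)\<bar>) q \<partial>lebesgue)"
      using q by (intro nn_integral_mono) (auto simp: indicator_def intro!: ennpow_mono dom)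
    also have "oscillation b \<beta> q ?Q \<le> ennreal C"
      using osc l by (auto simp: SUP_le_iff cubes_def)
    then have "(\<integral>\<^sup>+ x \<in> ?Q. ennpow (e2ennreal \<bar>ereal (b x) - enn2ereal (maximal_on ?Q b x)\<bar>) q \<partial>lebesgue)
        \<le> ennreal ((C * l powr \<beta>) powr q * l ^ CARD('n))"
      using l q C by (simp add: oscillation_le_iff)
    finally show "(\<integral>\<^sup>+ x \<in> ?Q. ennpow (ennreal (A a l - b x)) q \<partial>lebesgue)
        \<le> ennreal ((C * l powr \<beta>) powr q * l ^ CARD('n))" .
  qed (use C l in auto)
  have negative: "(\<integral>\<^sup>+ x \<in> cbox a (a + vec l). ennreal (\<bar>b x\<bar> - b x) \<partial>lebesgue)
      \<le> ennreal (2 * C * l powr \<beta> * l ^ CARD('n))" if l: "0 < l" for a l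
    using deviation_from_abs_average(1)[OF b l _ A_eq[OF l] key[OF l]] C l by (simp add: mult_ac)
  have mean: "(\<integral>\<^sup>+ x \<in> cbox a (a + vec l). ennreal \<bar>b x - A a l\<bar> \<partial>lebesgue)
      \<le> ennreal (4 * C * l powr \<beta> * l ^ CARD('n))" if l: "0 < l" for a l
    using deviation_from_abs_average(2)[OF b l _ A_eq[OF l] key[OF l]] C l by (simp add: mult_ac)
  \<comment> \<open>The summand 1 comes from the smaller cube and \<open>2 ^ CARD('n)\<close> from
    the ratio of the volumes, as \<open>l' \<le> 2 * l\<close>.\<close>
  define E where "E = 4 * C * (1 + 2 ^ CARD('n))"
  have near: "\<bar>A a l - A a' l'\<bar> \<le> E * l' powr \<beta>"
    if l: "0 < l" "l \<le> l'" "l' \<le> 2 * l" and sub: "cbox a (a + vec l) \<subseteq> cbox a' (a' + vec l')" for a l a' l'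
  proof -
    let ?Q = "cbox a (a + vec l)" and ?Q' = "cbox a' (a' + vec l')"
    have "ennreal (\<bar>A a l - A a' l'\<bar> * l ^ CARD('n)) = (\<integral>\<^sup>+ x \<in> ?Q. ennreal \<bar>A a l - A a' l'\<bar> \<partial>lebesgue)"
      using l by (simp add: nn_integral_cmult_indicator emeasure_cube ennreal_mult)
    also have "\<dots> \<le> (\<integral>\<^sup>+ x. ennreal \<bar>b x - A a l\<bar> * indicator ?Q x
        + ennreal \<bar>b x - A a' l'\<bar> * indicator ?Q' x \<partial>lebesgue)"
      using sub by (intro nn_integral_mono) (auto simp: indicator_def ennreal_plus[symmetric]
        simp del: ennreal_plus intro!: ennreal_leI)
    also have "\<dots> = (\<integral>\<^sup>+ x \<in> ?Q. ennreal \<bar>b x - A a l\<bar> \<partial>lebesgue) + (\<integral>\<^sup>+ x \<in> ?Q'. ennreal \<bar>b x - A a' l'\<bar> \<partial>lebesgue)"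
      by (intro nn_integral_add) measurable
    also have "\<dots> \<le> ennreal (4 * C * l powr \<beta> * l ^ CARD('n)) + ennreal (4 * C * l' powr \<beta> * l' ^ CARD('n))"
      using l by (intro add_mono mean) auto
    also have "\<dots> = ennreal (4 * C * l powr \<beta> * l ^ CARD('n) + 4 * C * l' powr \<beta> * l' ^ CARD('n))"
      using l C by (intro ennreal_plus[symmetric]) auto
    finally have "\<bar>A a l - A a' l'\<bar> * l ^ CARD('n) \<le> 4 * C * l powr \<beta> * l ^ CARD('n) + 4 * C * l' powr \<beta> * l' ^ CARD('n)"
      using l C by (subst (asm) ennreal_le_iff) auto
    also have "\<dots> \<le> 4 * C * l' powr \<beta> * l ^ CARD('n) + 4 * C * l' powr \<beta> * (2 * l) ^ CARD('n)"
      using l C \<beta> by (intro add_mono mult_mono mult_left_mono powr_mono2 power_mono) auto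
    also have "\<dots> = E * l' powr \<beta> * l ^ CARD('n)"
      by (simp add: E_def power_mult_distrib algebra_simps)
    finally show ?thesis
      using l by simp
  qed
  obtain g L where L: "0 \<le> L" and lip: "\<And>x y. \<bar>g x - g y\<bar> \<le> L * norm (x - y) powr \<beta>"
    and approx: "\<And>x l. 0 < l \<Longrightarrow> \<bar>g x - A x l\<bar> \<le> L * l powr \<beta>"
  proof (rule campanato_averages[of \<beta> E A])
    show "0 \<le> E"
      using C by (simp add: E_def)
  qed (use \<beta> near in auto)
  have "continuous_on UNIV g"
    using lipschitz_class_continuous[OF lip \<beta>] .
  then have [measurable]: "g \<in> borel_measurable lebesgue"
    by (simp add: borel_measurable_continuous_onI measurable_completion)
  have "AE x in lebesgue. ennreal \<bar>b x - g x\<bar> = 0"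
  proof (rule AE_eq_zero_of_cube_decay[OF _ \<beta>])
    \<comment> \<open>The three parts bound the mean of \<open>\<bar>b - A a l\<bar>\<close>, the
      variation of \<open>g\<close> over the cube, and
      \<open>\<bar>g a - A a l\<bar>\<close>.\<close>
    show "0 \<le> 4 * C + (L * real CARD('n) powr \<beta> + L)"
      using C L by simp
    fix a :: "real ^ 'n" and l :: real assume l: "0 < l"
    let ?Q = "cbox a (a + vec l)" and ?D = "(L * real CARD('n) powr \<beta> + L) * l powr \<beta>"
    have dist: "\<bar>A a l - g x\<bar> \<le> ?D" if "x \<in> ?Q" for x
    proof -
      have "a \<in> ?Q"
        using l by (simp add: mem_box_cart)
      then have "L * norm (x - a) powr \<beta> \<le> L * (real CARD('n) powr \<beta> * l powr \<beta>)"
        using that l \<beta> L by (intro mult_left_mono norm_powr_le_cube) auto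
      then show ?thesis
        using lip[of x a] approx[OF l, of a] by (simp add: algebra_simps)
    qed
    have "(\<integral>\<^sup>+ x \<in> ?Q. ennreal \<bar>b x - g x\<bar> \<partial>lebesgue)
        \<le> (\<integral>\<^sup>+ x. ennreal \<bar>b x - A a l\<bar> * indicator ?Q x + ennreal ?D * indicator ?Q x \<partial>lebesgue)"
    proof (rule nn_integral_mono)
      fix x
      have "\<bar>b x - g x\<bar> \<le> \<bar>b x - A a l\<bar> + ?D" "0 \<le> ?D" if "x \<in> ?Q"
        using dist[OF that] by linarith+
      then show "ennreal \<bar>b x - g x\<bar> * indicator ?Q x \<le> ennreal \<bar>b x - A a l\<bar> * indicator ?Q x + ennreal ?D * indicator ?Q x"
        by (auto simp: indicator_def ennreal_plus[symmetric] simp del: ennreal_plus intro!: ennreal_leI)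
    qed
    also have "\<dots> = (\<integral>\<^sup>+ x \<in> ?Q. ennreal \<bar>b x - A a l\<bar> \<partial>lebesgue) + ennreal ?D * ennreal (l ^ CARD('n))"
      using l by (subst nn_integral_add) (auto simp: nn_integral_cmult_indicator emeasure_cube)
    also have "\<dots> \<le> ennreal (4 * C * l powr \<beta> * l ^ CARD('n)) + ennreal ?D * ennreal (l ^ CARD('n))"
      using l by (intro add_right_mono mean)
    also have "\<dots> = ennreal (4 * C * l powr \<beta> * l ^ CARD('n) + ?D * l ^ CARD('n))"
      using l C L by (simp add: ennreal_mult[symmetric] ennreal_plus[symmetric] del: ennreal_mult'' ennreal_plus)
    also have "4 * C * l powr \<beta> * l ^ CARD('n) + ?D * l ^ CARD('n)
        = (4 * C + (L * real CARD('n) powr \<beta> + L)) * l powr \<beta> * l ^ CARD('n)"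
      by (simp add: algebra_simps)
    finally show "(\<integral>\<^sup>+ x \<in> ?Q. ennreal \<bar>b x - g x\<bar> \<partial>lebesgue)
        \<le> ennreal ((4 * C + (L * real CARD('n) powr \<beta> + L)) * l powr \<beta> * l ^ CARD('n))" .
  qed measurable
  then have "AE x in lebesgue. b x = g x"
    by eventually_elim simp
  then have "b \<in> lipschitz_space \<beta>"
    using lip by (auto simp: lipschitz_space_def lipschitz_class_def)
  \<comment> \<open>The same decay argument, applied to twice the negative part of
    \<open>b\<close>.\<close>
  moreover have "AE x in lebesgue. ennreal (\<bar>b x\<bar> - b x) = 0"
    using C by (intro AE_eq_zero_of_cube_decay[OF _ \<beta> _ negative]) auto
  then have "AE x in lebesgue. 0 \<le> b x"
    by eventually_elim (simp add: ennreal_eq_0_iff)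
  ultimately show ?thesis
    by blast
qed

section \<open>The range of \<open>q\<close> and the cycle of implications\<close>

theorem theorem1p4:
  fixes b :: "real ^ 'n \<Rightarrow> real" and \<beta> p q :: real
  assumes "locally_integrable b"
    and "0 < \<beta>" "\<beta> < 1"
    and "1 < p" "p < real CARD('n) / \<beta>"
    and "1 / q = 1 / p - \<beta> / real CARD('n)"
  shows "((b \<in> lipschitz_space \<beta> \<and> (AE x in lebesgue. 0 \<le> b x)) \<longleftrightarrow> commutator_bounded b p q)
       \<and> (commutator_bounded b p q \<longleftrightarrow>
           (\<exists>C>0. (SUP Q \<in> (cubes :: (real ^ 'n) set set). oscillation b \<beta> q Q) \<le> ennreal C))"
proof -
  let ?n = "real CARD('n)"
  \<comment> \<open>The upper bound on \<open>p\<close> makes \<open>1 / q\<close> positive, and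
    \<beta> > 0 makes \<open>q\<close> larger than \<open>p\<close>, hence larger than 1.\<close>
  have "\<beta> / ?n < 1 / p"
    using assms(2,4,5) by (simp add: field_simps)
  then have "0 < 1 / q" "1 / q < 1 / p"
    unfolding assms(6) using assms(2) by simp_all
  then have q0: "0 < q"
    by simp
  have q1: "1 < q"
  proof -
    have "p < q"
      using \<open>1 / q < 1 / p\<close> q0 assms(4) by (simp add: field_simps)
    then show ?thesis
      using assms(4) by simp
  qed
  have 12: "commutator_bounded b p q" if "b \<in> lipschitz_space \<beta>" "AE x in lebesgue. 0 \<le> b x"
    using that assms q0 by (intro commutator_bounded_of_lipschitz[of b \<beta>] locally_integrable_measurable) auto
  have 23: "\<exists>C>0. (SUP Q \<in> (cubes :: (real ^ 'n) set set). oscillation b \<beta> q Q) \<le> ennreal C"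
    if "commutator_bounded b p q"
    using that assms q0 by (intro oscillation_le_of_commutator_bounded) auto
  have 31: "b \<in> lipschitz_space \<beta> \<and> (AE x in lebesgue. 0 \<le> b x)"
    if "\<exists>C>0. (SUP Q \<in> (cubes :: (real ^ 'n) set set). oscillation b \<beta> q Q) \<le> ennreal C"
    using that lipschitz_of_oscillation[OF assms(1,2) q1] by blast
  show ?thesis
    using 12 23 31 by blast
qed

end
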